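(* Let $\alpha\ge-\frac12$, $1\le p\le q<\infty$, and let $\psi$ be a measurable function on $\mathbb{R}$ such that $$K_\psi=\int_{\mathbb{R}}\frac{|\psi(t)|}{|t|^{d_\alpha\left(1-\frac1q\right)}}\,dt<\infty .$$ Then for all $f\in\mathcal{L}^{p,q}(\mathbb{R},d\mu_\alpha)$ $$\|\mathcal{H}_\psi^\alpha f\|_{\mathcal{L}^{p,q}(\mathbb{R},d\mu_\alpha)}\le K_\psi\,\|f\|_{\mathcal{L}^{p,q}(\mathbb{R},d\mu_\alpha)} .$$
   Context: Notation: $d_\alpha=2\alpha+2$; $d\mu_\alpha(x)=A_\alpha|x|^{2\alpha+1}dx$ with $A_\alpha=(2^{\alpha+1}\Gamma(\alpha+1))^{-1}$; $B(0,r)=\,]-r,r[$ for $r>0$. Dunkl translation: put $W_\alpha(x,y,z)=(1-\sigma_{x,y,z}+\sigma_{z,x,y}+\sigma_{z,y,x})\,\kappa_\alpha(|x|,|y|,|z|)$, where $\sigma_{x,y,z}=\frac{x^2+y^2-z^2}{2xy}$ if $x,y\in\mathbb{R}\setminus\{0\}$ and $0$ otherwise, and $$\kappa_\alpha(|x|,|y|,|z|)=D_\alpha\frac{\big([(|x|+|y|)^2-z^2][z^2-(|x|-|y|)^2]\big)^{\alpha-\frac12}}{|xyz|^{2\alpha}}$$ if $|z|\in[\,||x|-|y||,\,|x|+|y|\,]$ and $0$ otherwise, with $D_\alpha=\frac{(\Gamma(\alpha+1))^2}{2^{\alpha-1}\sqrt{\pi}\,\Gamma(\alpha+\frac12)}$.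 Let $d\nu_{x,y}(z)=W_\alpha(x,y,z)\,d\mu_\alpha(z)$ if $x,y\ne0$, $\nu_{x,0}=\delta_x$, $\nu_{0,y}=\delta_y$. Then $\tau_x^\alpha f(y)=\int_{\mathbb{R}}f(z)\,d\nu_{x,y}(z)$ (for continuous $f$, and by the same formula for more general functions). For $\alpha=-\frac12$, $\tau_x^\alpha f(y)=f(x+y)$. Dunkl-type Campanato space: for $1\le p\le q<\infty$, $\mathcal{L}^{p,q}(\mathbb{R},d\mu_\alpha)$ is the space of locally $p$-integrable $f$ on $\mathbb{R}$ with $$\|f\|_{\mathcal{L}^{p,q}(\mathbb{R},d\mu_\alpha)}:=\sup_{r>0,\,x\in\mathbb{R}}r^{d_\alpha/q}\left(\frac{1}{\mu_\alpha(B(0,r))}\int_{B(0,r)}|\tau_x^\alpha f(y)-f^\alpha_{B(0,r)}(x)|^p\,d\mu_\alpha(y)\right)^{1/p}<\infty,$$ where $f^\alpha_{B(0,r)}(x)=\frac{1}{\mu_\alpha(B(0,r))}\int_{B(0,r)}\tau_x^\alpha f(y)\,d\mu_\alpha(y)$. Dunkl-type Hausdorff operator: $\mathcal{H}_\psi^\alpha f(x):=\int_{\mathbb{R}}\frac{\psi(t)}{|t|^{2\alpha+2}}f\!\left(\frac{x}{t}\right)dt$. *)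

theory Defs
  imports "HOL-Analysis.Analysis"
begin

definition dunkl_dim :: "real \<Rightarrow> real" where
  "dunkl_dim \<alpha> = 2 * \<alpha> + 2"

(* The density is taken over the complete Lebesgue measure, so that measurability
   with respect to dunkl_measure is Lebesgue measurability. *)
definition dunkl_measure :: "real \<Rightarrow> real measure" where
  "dunkl_measure \<alpha> = density lebesgue
     (\<lambda>x. ennreal (1 / (2 powr (\<alpha> + 1) * Gamma (\<alpha> + 1)) * \<bar>x\<bar> powr (2 * \<alpha> + 1)))"

definition dunkl_sigma :: "real \<Rightarrow> real \<Rightarrow> real \<Rightarrow> real" where
  "dunkl_sigma x y z = (if x \<noteq> 0 \<and> y \<noteq> 0 then (x\<^sup>2 + y\<^sup>2 - z\<^sup>2) / (2 * x * y) else 0)"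

definition dunkl_kappa :: "real \<Rightarrow> real \<Rightarrow> real \<Rightarrow> real \<Rightarrow> real" where
  "dunkl_kappa \<alpha> a b c =
     (if c \<in> {\<bar>a - b\<bar> .. a + b}
      then (Gamma (\<alpha> + 1))\<^sup>2 / (2 powr (\<alpha> - 1) * sqrt pi * Gamma (\<alpha> + 1 / 2))
           * ((((a + b)\<^sup>2 - c\<^sup>2) * (c\<^sup>2 - (a - b)\<^sup>2)) powr (\<alpha> - 1 / 2)
              / \<bar>a * b * c\<bar> powr (2 * \<alpha>))
      else 0)"

definition dunkl_W :: "real \<Rightarrow> real \<Rightarrow> real \<Rightarrow> real \<Rightarrow> real" where
  "dunkl_W \<alpha> x y z =
     (1 - dunkl_sigma x y z + dunkl_sigma z x y + dunkl_sigma z y x)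
       * dunkl_kappa \<alpha> \<bar>x\<bar> \<bar>y\<bar> \<bar>z\<bar>"

(* dunkl_W changes sign, so integration against the signed measure \<nu>_{x,y} is written out
   as integration of W times f; the two middle branches are the integrals against the
   Dirac measures \<nu>_{x,0} and \<nu>_{0,y}. *)
definition dunkl_translation :: "real \<Rightarrow> real \<Rightarrow> (real \<Rightarrow> complex) \<Rightarrow> real \<Rightarrow> complex" where
  "dunkl_translation \<alpha> x f y =
     (if \<alpha> = - 1 / 2 then f (x + y)
      else if y = 0 then f x
      else if x = 0 then f y
      else (LINT z|dunkl_measure \<alpha>. dunkl_W \<alpha> x y z *\<^sub>R f z))"

definition dunkl_mean :: "real \<Rightarrow> real \<Rightarrow> (real \<Rightarrow> complex) \<Rightarrow> real \<Rightarrow> complex" where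
  "dunkl_mean \<alpha> r f x =
     (LINT y:ball 0 r|dunkl_measure \<alpha>. dunkl_translation \<alpha> x f y)
       /\<^sub>R measure (dunkl_measure \<alpha>) (ball 0 r)"

(* Real powers on [0,\<infinity>], intended for exponents a > 0. *)
definition ennreal_power :: "ennreal \<Rightarrow> real \<Rightarrow> ennreal" where
  "ennreal_power x a = (if x = \<infinity> then \<infinity> else ennreal (enn2real x powr a))"

definition campanato_norm :: "real \<Rightarrow> real \<Rightarrow> real \<Rightarrow> (real \<Rightarrow> complex) \<Rightarrow> ennreal" where
  "campanato_norm \<alpha> p q f =
     (SUP r\<in>{0<..}. SUP x. ennreal (r powr (dunkl_dim \<alpha> / q)) *
        ennreal_power
          ((\<integral>\<^sup>+y\<in>ball 0 r. ennreal (norm (dunkl_translation \<alpha> x f y - dunkl_mean \<alpha> r f x) powr p)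
              \<partial>dunkl_measure \<alpha>) / emeasure (dunkl_measure \<alpha>) (ball 0 r))
          (1 / p))"

definition locally_p_integrable :: "real \<Rightarrow> real \<Rightarrow> (real \<Rightarrow> complex) \<Rightarrow> bool" where
  "locally_p_integrable \<alpha> p f \<longleftrightarrow>
     f \<in> borel_measurable (dunkl_measure \<alpha>) \<and>
     (\<forall>C. compact C \<longrightarrow> (\<integral>\<^sup>+x\<in>C. ennreal (norm (f x) powr p) \<partial>dunkl_measure \<alpha>) < \<infinity>)"

definition campanato_space :: "real \<Rightarrow> real \<Rightarrow> real \<Rightarrow> (real \<Rightarrow> complex) set" where
  "campanato_space \<alpha> p q = {f. locally_p_integrable \<alpha> p f \<and> campanato_norm \<alpha> p q f < \<infinity>}"

(* Where the integral does not converge absolutely, the value is 0 by the library convention.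
   This can happen almost everywhere: for a nonzero constant f (of seminorm 0) the integral
   converges iff \<psi> / |t|^(2 \<alpha> + 2) is integrable, which K_\<psi> < \<infinity> does not imply. *)
definition hausdorff_op :: "real \<Rightarrow> (real \<Rightarrow> complex) \<Rightarrow> (real \<Rightarrow> complex) \<Rightarrow> real \<Rightarrow> complex" where
  "hausdorff_op \<alpha> \<psi> f x = (LINT t|lebesgue. (\<psi> t /\<^sub>R \<bar>t\<bar> powr (2 * \<alpha> + 2)) * f (x / t))"

definition hausdorff_const :: "real \<Rightarrow> real \<Rightarrow> (real \<Rightarrow> complex) \<Rightarrow> ennreal" where
  "hausdorff_const \<alpha> q \<psi> =
     (\<integral>\<^sup>+t. ennreal (norm (\<psi> t) / \<bar>t\<bar> powr (dunkl_dim \<alpha> * (1 - 1 / q))) \<partial>lebesgue)"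

end

theory Submission
  imports Defs
begin

text \<open>
  Since \<open>\<tau>\<^sub>0\<close> is the identity, the seminorm at \<open>x = 0\<close> controls the oscillation of \<open>f\<close> about its
  means over centred balls. As \<open>q < \<infinity>\<close>, these means converge to a constant \<open>c\<close>, and \<open>f - c\<close> obeys a
  Morrey bound which together with \<open>K\<^sub>\<psi> < \<infinity>\<close> makes the integral defining \<open>\<H>(f - c)\<close> converge
  absolutely almost everywhere. If \<open>c = 0\<close> or the kernel \<open>\<phi>(t) = \<psi>(t) / |t|\<^bsup>2\<alpha>+2\<^esup>\<close> is integrable, the same
  holds for \<open>f\<close>; otherwise the integral for \<open>f\<close> diverges almost everywhere and \<open>\<H> f = 0\<close> almost
  everywhere by the convention for the integral. In the first case Fubini's theorem and the homogeneity
  of the translation kernel give \<open>\<tau>\<^sub>x(\<H> f)(y) = \<integral> \<phi>(t) \<tau>\<^bsub>x/t\<^esub> f(y/t) dt\<close> for almost every \<open>y\<close>, and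
  Minkowski's integral inequality concludes. Fubini's theorem applies because
  \<open>\<integral> |W(x, y, z)| d\<mu>(y)\<close> is bounded uniformly in \<open>x\<close> and \<open>z\<close>: the substitution \<open>s = y\<^sup>2\<close> turns it into a
  Beta integral.
\<close>

section \<open>Integral inequalities and almost everywhere equality\<close>

text \<open>Origin of the constant: replacing f by f(./t) costs a factor |t|^e with e = d_\<alpha>/q
  in every bound that decays like r^(-e), so a superposition of dilates with kernel \<phi> should
  cost \<integral> |\<phi>(t)| |t|^e dt, which is K_\<psi>. As no further factor is allowed,
  Minkowski's inequality must be sharp; the other estimates serve convergence or finiteness and may
  lose constants. The obstacle: the seminorm vanishes on constants and so does not control the
  integral defining the operator, and the means cannot be subtracted inside it because they depend
  on the radius. One constant for all radii is required. Centred balls suffice to find it because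
  dilations fix 0. The interchange with the translation involves t, y and z. What is known of
  \<integral> |\<phi>(t) f(z/t)| dt is local integrability in z, not a local bound, so the
  y-integral of the kernel has to be taken first; hence the bound in y instead of the usual one in
  z.\<close>

lemma ennreal_mult_add_mult:
  assumes "0 \<le> a" "0 \<le> b" "0 \<le> c" "0 \<le> d"
  shows "ennreal a * ennreal b + ennreal c * ennreal d = ennreal (a * b + c * d)"
  using assms by (simp add: ennreal_mult)

text \<open>Jensen's inequality for the measure k dt of total mass K, applied to h. It is the
  pointwise half of Minkowski's inequality; p-th powers are kept so that Tonelli's theorem can be
  applied to the right-hand side. The constant \<open>K powr (p - 1)\<close> is the sharp
  one.\<close>

lemma norm_integral_powr_le:
  fixes \<Phi> :: "'a \<Rightarrow> complex" and k h :: "'a \<Rightarrow> real"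
  assumes [measurable]: "\<Phi> \<in> borel_measurable M" "k \<in> borel_measurable M" "h \<in> borel_measurable M"
    and k0: "\<And>t. 0 \<le> k t" and h0: "\<And>t. 0 \<le> h t"
    and \<Phi>: "\<And>t. norm (\<Phi> t) \<le> k t * h t"
    and K: "(\<integral>\<^sup>+t. ennreal (k t) \<partial>M) = ennreal K" and K0: "0 \<le> K" and p: "1 \<le> p"
  shows "ennreal (norm (LINT t|M. \<Phi> t) powr p) \<le>
    ennreal (K powr (p - 1)) * (\<integral>\<^sup>+t. ennreal (k t * h t powr p) \<partial>M)"
proof (cases "norm (LINT t|M. \<Phi> t) = 0")
  \<comment> \<open>This case also covers a non-integrable \<open>\<Phi>\<close>, whose integral is
    0.\<close>
  case True
  then show ?thesis by simp
next
  case False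
  define P where "P = (\<integral>\<^sup>+t. ennreal (k t * h t powr p) \<partial>M)"
  have int: "integrable M \<Phi>"
    using False not_integrable_integral_eq by fastforce
  have le: "norm (LINT t|M. \<Phi> t) \<le> (\<integral>\<^sup>+t. ennreal (norm (\<Phi> t)) \<partial>M)"
    using integral_norm_bound_ennreal[OF int] by simp
  have Kpos: "K > 0"
  proof (rule ccontr)
    assume "\<not> K > 0"
    then have "(\<integral>\<^sup>+t. ennreal (k t) \<partial>M) = 0" using K K0 by auto
    then have "AE t in M. k t = 0"
      by (subst (asm) nn_integral_0_iff_AE) (auto simp: k0 antisym)
    then have "AE t in M. \<Phi> t = 0"
    proof eventually_elim
      case (elim t)
      then show ?case using \<Phi>[of t] by simp
    qed
    then have "(LINT t|M. \<Phi> t) = 0" by (rule integral_eq_zero_AE)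
    then show False using False by simp
  qed
  show ?thesis
  proof (cases "P = \<infinity>")
    case True
    then show ?thesis using Kpos p by (simp add: P_def ennreal_mult_top)
  next
    case False
    then obtain P' where P': "P = ennreal P'" "0 \<le> P'"
      by (cases P) auto
    have Ppos: "P' > 0"
    proof (rule ccontr)
      assume "\<not> P' > 0"
      then have "P = 0" using P' by auto
      then have "AE t in M. k t * h t powr p = 0"
        unfolding P_def
        by (subst (asm) nn_integral_0_iff_AE) (auto simp: k0 h0 antisym mult_nonneg_nonneg)
      then have "AE t in M. \<Phi> t = 0"
      proof eventually_elim
        case (elim t)
        then show ?case using \<Phi>[of t] by auto
      qed
      then have "(LINT t|M. \<Phi> t) = 0" by (rule integral_eq_zero_AE)
      then show False using \<open>norm (LINT t|M. \<Phi> t) \<noteq> 0\<close> by simp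
    qed
    \<comment> \<open>The minimiser in s of
      \<open>s powr (1 - p) / p * P' + s * (1 - 1 / p) * K\<close>, the bound that
      \<open>young\<close> gives after integration; at this s the two terms add up to
      \<open>K * s\<close>.\<close>
    define s where "s = (P' / K) powr (1 / p)"
    have s: "s > 0" using Ppos Kpos by (simp add: s_def)
    have c0: "0 \<le> s powr (1 - p) / p" "0 \<le> s * (1 - 1 / p)" using s p by auto
    \<comment> \<open>Young's inequality for a and s^(p-1) with exponents p and p/(p-1), divided by
      s^(p-1); for p = 1 the second term vanishes.\<close>
    have young: "a \<le> s powr (1 - p) / p * a powr p + s * (1 - 1 / p)" if "0 \<le> a" for a
    proof (cases "a = 0")
      case True
      then show ?thesis using c0 by simp
    next
      case False
      have "(a powr p) powr (1 / p) * (s powr p) powr (1 - 1 / p)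
          \<le> (1 / p) * a powr p + (1 - 1 / p) * s powr p"
        using p s False that by (intro Youngs_inequality_0) auto
      moreover have "(a powr p) powr (1 / p) = a" using that p by (simp add: powr_powr)
      moreover have "(s powr p) powr (1 - 1 / p) = s powr (p - 1)"
        using p by (simp add: powr_powr right_diff_distrib)
      ultimately have "a * s powr (p - 1) \<le> (1 / p) * a powr p + (1 - 1 / p) * s powr p" by simp
      then have "a * s powr (p - 1) * s powr (1 - p) \<le>
         ((1 / p) * a powr p + (1 - 1 / p) * s powr p) * s powr (1 - p)"
        by (intro mult_right_mono) auto
      moreover have "s powr (p - 1) * s powr (1 - p) = 1" "s powr p * s powr (1 - p) = s"
        using s by (simp_all flip: powr_add)
      ultimately show ?thesis by (simp add: algebra_simps)
    qed
    have "(\<integral>\<^sup>+t. ennreal (norm (\<Phi> t)) \<partial>M) \<le>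
       (\<integral>\<^sup>+t. ennreal (s powr (1 - p) / p) * ennreal (k t * h t powr p) +
              ennreal (s * (1 - 1 / p)) * ennreal (k t) \<partial>M)"
    proof (rule nn_integral_mono)
      fix t
      have "norm (\<Phi> t) \<le> k t * (s powr (1 - p) / p * h t powr p + s * (1 - 1 / p))"
        using \<Phi>[of t] mult_left_mono[OF young[OF h0[of t]] k0[of t]] by linarith
      then have "norm (\<Phi> t) \<le> s powr (1 - p) / p * (k t * h t powr p) + s * (1 - 1 / p) * k t"
        by (simp add: algebra_simps)
      then show "ennreal (norm (\<Phi> t)) \<le> ennreal (s powr (1 - p) / p) * ennreal (k t * h t powr p) +
              ennreal (s * (1 - 1 / p)) * ennreal (k t)"
        using c0 k0[of t] h0[of t]
        by (subst ennreal_mult_add_mult) (simp_all add: ennreal_leI)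
    qed
    also have "\<dots> = ennreal (s powr (1 - p) / p) * P + ennreal (s * (1 - 1 / p)) * ennreal K"
      by (simp add: nn_integral_add nn_integral_cmult P_def K)
    also have "\<dots> = ennreal (s powr (1 - p) / p * P' + s * (1 - 1 / p) * K)"
      unfolding P'(1) using c0 P' K0 by (intro ennreal_mult_add_mult) auto
    finally have "ennreal (norm (LINT t|M. \<Phi> t)) \<le> ennreal (s powr (1 - p) / p * P' + s * (1 - 1 / p) * K)"
      using le by (rule order_trans[rotated])
    moreover have "0 \<le> s powr (1 - p) / p * P' + s * (1 - 1 / p) * K"
      using mult_nonneg_nonneg[OF c0(1) P'(2)] mult_nonneg_nonneg[OF c0(2) K0] by linarith
    ultimately have "norm (LINT t|M. \<Phi> t) \<le> s powr (1 - p) / p * P' + s * (1 - 1 / p) * K"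
      by (simp only: ennreal_le_iff)
    also have "s powr (1 - p) / p * P' = K * s / p"
    proof -
      have "s powr p = P' / K" using Ppos Kpos p by (simp add: s_def powr_powr)
      then have "P' = K * s powr p" using Kpos by simp
      moreover have "s powr (1 - p) * s powr p = s" using s by (simp flip: powr_add)
      ultimately show ?thesis by (simp add: algebra_simps)
    qed
    also have "K * s / p + s * (1 - 1 / p) * K = K * s" by (simp add: algebra_simps)
    finally have "norm (LINT t|M. \<Phi> t) powr p \<le> (K * s) powr p"
      using p by (intro powr_mono2) auto
    also have "\<dots> = K powr p * (P' / K)"
      using Ppos Kpos p s by (simp add: powr_mult s_def powr_powr)
    also have "\<dots> = K powr (p - 1) * P'"
      using Kpos by (simp add: powr_diff)
    finally show ?thesis
      using P' unfolding P_def by (simp add: ennreal_leI flip: ennreal_mult)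
  qed
qed

text \<open>For a non-integrable h the left-hand side is 0.\<close>

lemma norm_integral_le_nn_integral:
  fixes h :: "'a \<Rightarrow> complex"
  shows "ennreal (norm (LINT z|M. h z)) \<le> (\<integral>\<^sup>+z. ennreal (norm (h z)) \<partial>M)"
  by (cases "integrable M h") (simp_all add: integral_norm_bound_ennreal not_integrable_integral_eq)

text \<open>The crude constant \<open>2 powr p\<close> is acceptable because it enters only
  qualitative bounds and never the final constant.\<close>

lemma norm_add_powr_le:
  fixes a b :: complex
  assumes "0 \<le> p"
  shows "norm (a + b) powr p \<le> 2 powr p * (norm a powr p + norm b powr p)"
proof -
  have "norm (a + b) powr p \<le> (2 * max (norm a) (norm b)) powr p"
    using assms norm_triangle_ineq[of a b] by (intro powr_mono2) auto
  also have "\<dots> = 2 powr p * max (norm a) (norm b) powr p"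
    by (simp add: powr_mult)
  also have "\<dots> \<le> 2 powr p * (norm a powr p + norm b powr p)"
    by (intro mult_left_mono) (auto simp: max_def)
  finally show ?thesis .
qed

lemma (in pair_sigma_finite) integrable_pairI:
  fixes f :: "'a \<Rightarrow> 'b \<Rightarrow> complex"
  assumes [measurable]: "case_prod f \<in> borel_measurable (M1 \<Otimes>\<^sub>M M2)"
    and "(\<integral>\<^sup>+x. \<integral>\<^sup>+y. ennreal (norm (f x y)) \<partial>M2 \<partial>M1) < \<infinity>"
  shows "integrable (M1 \<Otimes>\<^sub>M M2) (case_prod f)"
proof (rule integrableI_bounded)
  have "(\<integral>\<^sup>+z. ennreal (norm (case_prod f z)) \<partial>(M1 \<Otimes>\<^sub>M M2)) =
    (\<integral>\<^sup>+x. \<integral>\<^sup>+y. ennreal (norm (f x y)) \<partial>M2 \<partial>M1)"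
    by (subst M2.nn_integral_fst[symmetric]) auto
  then show "(\<integral>\<^sup>+z. ennreal (norm (case_prod f z)) \<partial>(M1 \<Otimes>\<^sub>M M2)) < \<infinity>"
    using assms(2) by simp
qed simp

section \<open>Borel representatives and null sets\<close>

text \<open>Fubini's theorem is applied on products of Borel sigma-algebras, where (t, y) \<mapsto>
  f(y/t) is measurable for Borel f; f and \<psi> are therefore exchanged for Borel functions. Real
  and imaginary parts are treated separately.\<close>

lemma lebesgue_AE_eq_borel:
  fixes f :: "real \<Rightarrow> complex"
  assumes "f \<in> borel_measurable lebesgue"
  obtains g where "g \<in> borel_measurable borel" "AE x in lborel. f x = g x"
proof -
  have "(\<lambda>x. Re (f x)) \<in> borel_measurable (completion lborel)"
    "(\<lambda>x. Im (f x)) \<in> borel_measurable (completion lborel)"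
    using assms by measurable
  from this[THEN completion_ex_borel_measurable_real]
  obtain u v where "u \<in> borel_measurable lborel" "AE x in lborel. Re (f x) = u x"
    and "v \<in> borel_measurable lborel" "AE x in lborel. Im (f x) = v x" by blast
  moreover from this have "AE x in lborel. f x = Complex (u x) (v x)"
    by (auto simp: complex_eq_iff)
  moreover have "(\<lambda>x. Complex (u x) (v x)) \<in> borel_measurable borel"
    using calculation unfolding Complex_eq by measurable
  ultimately show ?thesis using that by blast
qed

lemma measurable_lebesgue_AE:
  fixes f g :: "real \<Rightarrow> complex"
  assumes "g \<in> borel_measurable borel" "AE x in lborel. f x = g x"
  shows "f \<in> borel_measurable lebesgue"
proof -
  have "g \<in> borel_measurable lebesgue" using assms(1) by (simp add: measurable_completion)
  moreover have "AE x in lebesgue. g x = f x"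
    using assms(2) by (intro AE_completion) (auto elim: eventually_mono)
  ultimately show ?thesis by (rule borel_measurable_AE)
qed

text \<open>The substitution s = x/t is differentiable off 0 and so maps null sets to null sets. For
  x = 0 it would be constant, and a change of f at the single point 0 could matter for all
  t.\<close>

lemma AE_lborel_inverse:
  fixes P :: "real \<Rightarrow> bool" and x :: real
  assumes "AE s in lborel. P s" "x \<noteq> 0"
  shows "AE t in lborel. P (x / t)"
proof -
  define N where "N = {s. s \<noteq> 0 \<and> \<not> P s}"
  have "AE s in lebesgue. P s" using assms(1) by (rule AE_completion)
  then have "{s. \<not> P s} \<in> null_sets lebesgue"
    by (simp add: completion.AE_iff_null_sets)
  then have "negligible {s. \<not> P s}" by (simp add: negligible_iff_null_sets)
  then have "negligible N" by (rule negligible_subset) (auto simp: N_def)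
  then have "negligible ((\<lambda>s. x / s) ` N)"
    by (rule negligible_differentiable_image_negligible[rotated])
       (auto simp: N_def differentiable_on_def intro!: derivative_intros)
  then have "negligible (insert 0 ((\<lambda>s. x / s) ` N))" by simp
  \<comment> \<open>The point t = 0 is added by hand: there \<open>x / t\<close> is 0 by convention,
    and 0 is excluded from \<open>N\<close>.\<close>
  moreover have "{t. \<not> P (x / t)} \<subseteq> insert 0 ((\<lambda>s. x / s) ` N)"
  proof
    fix t assume t: "t \<in> {t. \<not> P (x / t)}"
    show "t \<in> insert 0 ((\<lambda>s. x / s) ` N)"
    proof (cases "t = 0")
      case False
      then have "x / t \<in> N" "t = x / (x / t)" using t assms(2) by (auto simp: N_def)
      then show ?thesis by blast
    qed simp
  qed
  ultimately have "negligible {t. \<not> P (x / t)}" by (rule negligible_subset)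
  then have "AE t in lebesgue. P (x / t)"
    by (simp add: negligible_iff_null_sets completion.AE_iff_null_sets)
  then show ?thesis by (simp add: AE_completion_iff)
qed

section \<open>The Dunkl measure\<close>

definition dunkl_weight :: "real \<Rightarrow> real \<Rightarrow> real" where
  "dunkl_weight \<alpha> x = 1 / (2 powr (\<alpha> + 1) * Gamma (\<alpha> + 1)) * \<bar>x\<bar> powr (2 * \<alpha> + 1)"

text \<open>The same density over the Borel sigma-algebra, so that measurability for products with
  this measure is Borel measurability. Borel functions have the same integrals under
  \<open>dunkl_measure\<close>.\<close>

definition dunkl_borel :: "real \<Rightarrow> real measure" where
  "dunkl_borel \<alpha> = density lborel (\<lambda>x. ennreal (dunkl_weight \<alpha> x))"

lemma measurable_dunkl_weight [measurable]: "dunkl_weight \<alpha> \<in> borel_measurable borel"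
  unfolding dunkl_weight_def by measurable

lemma sets_dunkl_borel [simp, measurable_cong]: "sets (dunkl_borel \<alpha>) = sets borel"
  by (simp add: dunkl_borel_def)

lemma space_dunkl_borel [simp]: "space (dunkl_borel \<alpha>) = UNIV"
  by (simp add: dunkl_borel_def)

lemma sets_dunkl_measure: "sets (dunkl_measure \<alpha>) = sets lebesgue"
  by (simp add: dunkl_measure_def)

lemma space_dunkl_measure [simp]: "space (dunkl_measure \<alpha>) = UNIV"
  by (simp add: dunkl_measure_def)

lemma borel_measurable_dunkl_measure:
  "f \<in> borel_measurable (dunkl_measure \<alpha>) \<longleftrightarrow> f \<in> borel_measurable lebesgue"
  by (intro arg_cong2[where f="(\<in>)"] measurable_cong_sets refl sets_dunkl_measure)

lemma sets_borel_ball [measurable]: "ball (c :: real) r \<in> sets borel"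
  by simp

lemma dunkl_weight_pos:
  assumes "\<alpha> \<ge> - 1 / 2" "x \<noteq> 0"
  shows "0 < dunkl_weight \<alpha> x"
  using assms by (simp add: dunkl_weight_def Gamma_real_pos)

lemma dunkl_weight_nonneg:
  assumes "\<alpha> \<ge> - 1 / 2"
  shows "0 \<le> dunkl_weight \<alpha> x"
  using assms by (simp add: dunkl_weight_def Gamma_real_pos less_imp_le)

lemma dunkl_measure_alt:
  "dunkl_measure \<alpha> = density lebesgue (\<lambda>x. ennreal (dunkl_weight \<alpha> x))"
  by (simp add: dunkl_measure_def dunkl_weight_def)

lemma nn_integral_dunkl_borel:
  assumes [measurable]: "f \<in> borel_measurable borel"
  shows "(\<integral>\<^sup>+x. f x \<partial>dunkl_borel \<alpha>) = (\<integral>\<^sup>+x. ennreal (dunkl_weight \<alpha> x) * f x \<partial>lborel)"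
  unfolding dunkl_borel_def by (subst nn_integral_density) auto

lemma nn_integral_dunkl_measure:
  assumes [measurable]: "f \<in> borel_measurable borel"
  shows "(\<integral>\<^sup>+x. f x \<partial>dunkl_measure \<alpha>) = (\<integral>\<^sup>+x. f x \<partial>dunkl_borel \<alpha>)"
  unfolding dunkl_measure_alt nn_integral_dunkl_borel[OF assms]
  by (subst nn_integral_density) (auto simp: nn_integral_completion intro: measurable_completion)

lemma integral_dunkl_borel:
  fixes f :: "real \<Rightarrow> complex"
  assumes "\<alpha> \<ge> - 1 / 2" and [measurable]: "f \<in> borel_measurable borel"
  shows "(LINT x|dunkl_borel \<alpha>. f x) = (LINT x|lborel. dunkl_weight \<alpha> x *\<^sub>R f x)"
  unfolding dunkl_borel_def using dunkl_weight_nonneg[OF assms(1)]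
  by (subst integral_density) auto

lemma integral_dunkl_measure:
  fixes f :: "real \<Rightarrow> complex"
  assumes "\<alpha> \<ge> - 1 / 2" and [measurable]: "f \<in> borel_measurable borel"
  shows "(LINT x|dunkl_measure \<alpha>. f x) = (LINT x|dunkl_borel \<alpha>. f x)"
  unfolding dunkl_measure_alt integral_dunkl_borel[OF assms]
  using dunkl_weight_nonneg[OF assms(1)]
  by (subst integral_density) (auto simp: integral_completion intro: measurable_completion)

text \<open>The weight is positive except at 0, where it vanishes for every \<alpha> because
  \<open>0 powr a\<close> is 0.\<close>

lemma AE_dunkl_borel_iff:
  assumes "\<alpha> \<ge> - 1 / 2"
  shows "(AE x in dunkl_borel \<alpha>. P x) \<longleftrightarrow> (AE x in lborel. P x)"
proof -
  have "(AE x in dunkl_borel \<alpha>. P x) \<longleftrightarrow> (AE x in lborel. 0 < ennreal (dunkl_weight \<alpha> x) \<longrightarrow> P x)"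
    unfolding dunkl_borel_def by (subst AE_density) auto
  also have "\<dots> \<longleftrightarrow> (AE x in lborel. P x)"
  proof
    assume "AE x in lborel. 0 < ennreal (dunkl_weight \<alpha> x) \<longrightarrow> P x"
    with AE_lborel_singleton[of "0::real"] show "AE x in lborel. P x"
      by eventually_elim (simp add: dunkl_weight_pos[OF assms])
  qed (auto elim: eventually_mono)
  finally show ?thesis .
qed

lemma AE_dunkl_measure_iff:
  assumes "\<alpha> \<ge> - 1 / 2"
  shows "(AE x in dunkl_measure \<alpha>. P x) \<longleftrightarrow> (AE x in lborel. P x)"
proof -
  have "(AE x in dunkl_measure \<alpha>. P x) \<longleftrightarrow> (AE x in lebesgue. 0 < ennreal (dunkl_weight \<alpha> x) \<longrightarrow> P x)"
    unfolding dunkl_measure_alt by (subst AE_density) (auto intro: measurable_completion)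
  also have "\<dots> \<longleftrightarrow> (AE x in lborel. 0 < ennreal (dunkl_weight \<alpha> x) \<longrightarrow> P x)"
    by (rule AE_completion_iff)
  also have "\<dots> \<longleftrightarrow> (AE x in dunkl_borel \<alpha>. P x)"
    unfolding dunkl_borel_def by (subst AE_density) auto
  finally show ?thesis using AE_dunkl_borel_iff[OF assms] by simp
qed

lemma sigma_finite_dunkl_borel: "sigma_finite_measure (dunkl_borel \<alpha>)"
  unfolding dunkl_borel_def
  by (subst sigma_finite_measure.sigma_finite_iff_density_finite[OF sigma_finite_lborel]) auto

section \<open>Homogeneity of the measure and volumes of balls\<close>

lemma dunkl_weight_mult:
  "dunkl_weight \<alpha> (t * x) = \<bar>t\<bar> powr (2 * \<alpha> + 1) * dunkl_weight \<alpha> x"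
  by (simp add: dunkl_weight_def abs_mult powr_mult)

lemma abs_mult_powr_dunkl_dim:
  "t \<noteq> 0 \<Longrightarrow> \<bar>t\<bar> * \<bar>t\<bar> powr (2 * \<alpha> + 1) = \<bar>t\<bar> powr dunkl_dim \<alpha>"
proof -
  assume "t \<noteq> 0"
  then have "\<bar>t\<bar> * \<bar>t\<bar> powr (2 * \<alpha> + 1) = \<bar>t\<bar> powr 1 * \<bar>t\<bar> powr (2 * \<alpha> + 1)" by simp
  also have "\<dots> = \<bar>t\<bar> powr dunkl_dim \<alpha>"
    unfolding dunkl_dim_def by (simp only: powr_add[symmetric]) (simp add: algebra_simps)
  finally show ?thesis .
qed

text \<open>The measure is homogeneous of degree d_\<alpha>: the substitution contributes |t| and
  the weight |t|^(2\<alpha>+1).\<close>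

lemma nn_integral_dunkl_borel_scale:
  assumes [measurable]: "f \<in> borel_measurable borel" and t: "t \<noteq> 0"
  shows "(\<integral>\<^sup>+x. f (x / t) \<partial>dunkl_borel \<alpha>) =
    ennreal (\<bar>t\<bar> powr dunkl_dim \<alpha>) * (\<integral>\<^sup>+x. f x \<partial>dunkl_borel \<alpha>)"
proof -
  have "(\<integral>\<^sup>+x. f (x / t) \<partial>dunkl_borel \<alpha>) =
      (\<integral>\<^sup>+x. ennreal (dunkl_weight \<alpha> x) * f (x / t) \<partial>lborel)"
    by (rule nn_integral_dunkl_borel) measurable
  also have "\<dots> = ennreal \<bar>t\<bar> *
      (\<integral>\<^sup>+x. ennreal (dunkl_weight \<alpha> (0 + t * x)) * f ((0 + t * x) / t) \<partial>lborel)"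
    by (rule nn_integral_real_affine[OF _ t]) measurable
  also have "\<dots> = ennreal \<bar>t\<bar> * (\<integral>\<^sup>+x. ennreal (\<bar>t\<bar> powr (2 * \<alpha> + 1)) *
      (ennreal (dunkl_weight \<alpha> x) * f x) \<partial>lborel)"
    using t by (simp add: dunkl_weight_mult ennreal_mult' mult.assoc)
  also have "\<dots> = ennreal (\<bar>t\<bar> powr dunkl_dim \<alpha>) * (\<integral>\<^sup>+x. f x \<partial>dunkl_borel \<alpha>)"
    by (subst nn_integral_cmult)
       (auto simp: nn_integral_dunkl_borel abs_mult_powr_dunkl_dim[OF t, symmetric]
         ennreal_mult mult.assoc)
  finally show ?thesis .
qed

lemma integral_dunkl_borel_scale:
  fixes f :: "real \<Rightarrow> complex"
  assumes "\<alpha> \<ge> - 1 / 2" and [measurable]: "f \<in> borel_measurable borel" and t: "t \<noteq> 0"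
  shows "(LINT x|dunkl_borel \<alpha>. f (x / t)) =
    (\<bar>t\<bar> powr dunkl_dim \<alpha>) *\<^sub>R (LINT x|dunkl_borel \<alpha>. f x)"
proof -
  have "(LINT x|dunkl_borel \<alpha>. f (x / t)) =
      (LINT x|lborel. dunkl_weight \<alpha> x *\<^sub>R f (x / t))"
    by (rule integral_dunkl_borel) (use assms in measurable)
  also have "\<dots> = \<bar>t\<bar> *\<^sub>R
      (LINT x|lborel. dunkl_weight \<alpha> (0 + t * x) *\<^sub>R f ((0 + t * x) / t))"
    by (rule lborel_integral_real_affine[OF t])
  also have "\<dots> = \<bar>t\<bar> *\<^sub>R (LINT x|lborel. \<bar>t\<bar> powr (2 * \<alpha> + 1) *\<^sub>R
      (dunkl_weight \<alpha> x *\<^sub>R f x))"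
    using t by (simp add: dunkl_weight_mult)
  also have "\<dots> = (\<bar>t\<bar> * \<bar>t\<bar> powr (2 * \<alpha> + 1)) *\<^sub>R (LINT x|dunkl_borel \<alpha>. f x)"
    unfolding integral_dunkl_borel[OF assms(1,2)] integral_scaleR_right by simp
  finally show ?thesis by (simp only: abs_mult_powr_dunkl_dim[OF t])
qed

definition dunkl_vol :: "real \<Rightarrow> real \<Rightarrow> real" where
  "dunkl_vol \<alpha> r = measure (dunkl_borel \<alpha>) (ball 0 r)"

lemma ball_scale: "t \<noteq> 0 \<Longrightarrow> y / t \<in> ball 0 (r / \<bar>t\<bar>) \<longleftrightarrow> y \<in> ball (0::real) r"
  by (simp add: divide_less_cancel)

lemma indicator_ball_scale:
  "t \<noteq> 0 \<Longrightarrow> indicator (ball 0 (r / \<bar>t\<bar>)) (y / t) = indicator (ball (0::real) r) y"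
  unfolding indicator_def using ball_scale by simp

text \<open>Finiteness holds because the weight is nondecreasing in |x| (2\<alpha>+1 \<ge> 0),
  positivity because a ball is not a null set. The dilation formula applied to an indicator gives
  the scaling law, and its case t = r determines the volume up to its value at radius 1.\<close>

lemma emeasure_dunkl_borel_ball:
  assumes "\<alpha> \<ge> - 1 / 2"
  shows "emeasure (dunkl_borel \<alpha>) (ball 0 r) = ennreal (dunkl_vol \<alpha> r)"
    and "0 < r \<Longrightarrow> 0 < dunkl_vol \<alpha> r"
    and "t \<noteq> 0 \<Longrightarrow> dunkl_vol \<alpha> (r / \<bar>t\<bar>) = dunkl_vol \<alpha> r / \<bar>t\<bar> powr dunkl_dim \<alpha>"
    and "0 < r \<Longrightarrow> dunkl_vol \<alpha> r = dunkl_vol \<alpha> 1 * r powr dunkl_dim \<alpha>"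
proof -
  have fin: "emeasure (dunkl_borel \<alpha>) (ball 0 r) < \<infinity>" for r
  proof -
    have "emeasure (dunkl_borel \<alpha>) (ball 0 r) =
        (\<integral>\<^sup>+x. ennreal (dunkl_weight \<alpha> x) * indicator (ball 0 r) x \<partial>lborel)"
      unfolding dunkl_borel_def by (subst emeasure_density) auto
    also have "\<dots> \<le> (\<integral>\<^sup>+x. ennreal (dunkl_weight \<alpha> r) * indicator (ball (0::real) r) x \<partial>lborel)"
    proof (rule nn_integral_mono)
      fix x :: real
      have "dunkl_weight \<alpha> x \<le> dunkl_weight \<alpha> r" if "\<bar>x\<bar> < r"
        unfolding dunkl_weight_def using assms that
        by (intro mult_left_mono powr_mono2) (auto simp: Gamma_real_pos less_imp_le)
      then show "ennreal (dunkl_weight \<alpha> x) * indicator (ball 0 r) x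
          \<le> ennreal (dunkl_weight \<alpha> r) * indicator (ball 0 r) x"
        by (auto simp: indicator_def intro!: ennreal_leI)
    qed
    also have "\<dots> = ennreal (dunkl_weight \<alpha> r) * emeasure lborel (ball (0::real) r)"
      by (subst nn_integral_cmult_indicator) auto
    also have "\<dots> < \<infinity>"
      using emeasure_bounded_finite[of "ball (0::real) r"] by (simp add: ennreal_mult_less_top)
    finally show ?thesis .
  qed
  show em: "emeasure (dunkl_borel \<alpha>) (ball 0 r) = ennreal (dunkl_vol \<alpha> r)" for r
    using fin[of r] by (simp add: dunkl_vol_def emeasure_eq_ennreal_measure)
  show pos: "0 < dunkl_vol \<alpha> r" if "0 < r" for r
  proof (rule ccontr)
    assume "\<not> 0 < dunkl_vol \<alpha> r"
    then have "emeasure (dunkl_borel \<alpha>) (ball 0 r) = 0"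
      by (simp add: em ennreal_eq_0_iff)
    then have "AE x in dunkl_borel \<alpha>. x \<notin> ball 0 r"
      by (intro AE_I'[of "ball 0 r"]) (auto simp: null_sets_def)
    then have "AE x in lborel. x \<notin> ball (0::real) r"
      by (simp add: AE_dunkl_borel_iff[OF assms])
    then have "emeasure lborel (ball (0::real) r) = 0"
      using AE_iff_measurable[of "ball (0::real) r" lborel "\<lambda>x. x \<notin> ball 0 r"]
      by (auto simp: ball_def)
    then show False using that by (simp add: ball_eq_greaterThanLessThan)
  qed
  show sc: "dunkl_vol \<alpha> (r / \<bar>t\<bar>) = dunkl_vol \<alpha> r / \<bar>t\<bar> powr dunkl_dim \<alpha>" if "t \<noteq> 0" for r t
  proof -
    have "ennreal (dunkl_vol \<alpha> r) = (\<integral>\<^sup>+y. indicator (ball 0 (r / \<bar>t\<bar>)) (y / t) \<partial>dunkl_borel \<alpha>)"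
      unfolding indicator_ball_scale[OF that] by (simp add: em)
    also have "\<dots> = ennreal (\<bar>t\<bar> powr dunkl_dim \<alpha>) * ennreal (dunkl_vol \<alpha> (r / \<bar>t\<bar>))"
      by (subst nn_integral_dunkl_borel_scale[OF _ that]) (auto simp: em)
    finally have "dunkl_vol \<alpha> r = \<bar>t\<bar> powr dunkl_dim \<alpha> * dunkl_vol \<alpha> (r / \<bar>t\<bar>)"
      by (simp add: dunkl_vol_def flip: ennreal_mult)
    then show ?thesis using that by simp
  qed
  show "dunkl_vol \<alpha> r = dunkl_vol \<alpha> 1 * r powr dunkl_dim \<alpha>" if "0 < r"
  proof -
    have "dunkl_vol \<alpha> 1 = dunkl_vol \<alpha> r / r powr dunkl_dim \<alpha>"
      using sc[of r r] that by simp
    then show ?thesis using that by simp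
  qed
qed

lemma emeasure_dunkl_measure_ball:
  assumes "\<alpha> \<ge> - 1 / 2"
  shows "emeasure (dunkl_measure \<alpha>) (ball 0 r) = ennreal (dunkl_vol \<alpha> r)"
proof -
  have "emeasure (dunkl_measure \<alpha>) (ball 0 r) = (\<integral>\<^sup>+x. indicator (ball 0 r) x \<partial>dunkl_measure \<alpha>)"
    by (simp add: sets_dunkl_measure)
  also have "\<dots> = (\<integral>\<^sup>+x. indicator (ball 0 r) x \<partial>dunkl_borel \<alpha>)"
    by (rule nn_integral_dunkl_measure) auto
  also have "\<dots> = ennreal (dunkl_vol \<alpha> r)"
    by (simp add: emeasure_dunkl_borel_ball(1)[OF assms])
  finally show ?thesis .
qed

lemma measure_dunkl_measure_ball:
  assumes "\<alpha> \<ge> - 1 / 2"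
  shows "measure (dunkl_measure \<alpha>) (ball 0 r) = dunkl_vol \<alpha> r"
  using emeasure_dunkl_measure_ball[OF assms] by (simp add: measure_def dunkl_vol_def)

lemma nn_integral_dunkl_ball_scale:
  assumes [measurable]: "f \<in> borel_measurable borel" and t: "t \<noteq> 0"
  shows "(\<integral>\<^sup>+y\<in>ball 0 r. f (y / t) \<partial>dunkl_borel \<alpha>) =
    ennreal (\<bar>t\<bar> powr dunkl_dim \<alpha>) * (\<integral>\<^sup>+y\<in>ball 0 (r / \<bar>t\<bar>). f y \<partial>dunkl_borel \<alpha>)"
proof -
  have "(\<lambda>y. f y * indicator (ball 0 (r / \<bar>t\<bar>)) y) \<in> borel_measurable borel" by auto
  from nn_integral_dunkl_borel_scale[OF this t, of \<alpha>] show ?thesis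
    by (simp only: indicator_ball_scale[OF t])
qed

lemma integral_dunkl_ball_scale:
  fixes f :: "real \<Rightarrow> complex"
  assumes "\<alpha> \<ge> - 1 / 2" and [measurable]: "f \<in> borel_measurable borel" and t: "t \<noteq> 0"
  shows "(LINT y:ball 0 r|dunkl_borel \<alpha>. f (y / t)) =
    (\<bar>t\<bar> powr dunkl_dim \<alpha>) *\<^sub>R (LINT y:ball 0 (r / \<bar>t\<bar>)|dunkl_borel \<alpha>. f y)"
proof -
  have "(\<lambda>y. indicator (ball 0 (r / \<bar>t\<bar>)) y *\<^sub>R f y) \<in> borel_measurable borel" by auto
  from integral_dunkl_borel_scale[OF assms(1) this t] show ?thesis
    unfolding set_lebesgue_integral_def by (simp only: indicator_ball_scale[OF t])
qed

text \<open>For \<alpha> = -1/2 the translation is the ordinary shift, the measure is a multiple of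
  Lebesgue measure, and x + B(0,R) lies in B(0,R+|x|).\<close>

lemma nn_integral_ball_shift:
  fixes h :: "real \<Rightarrow> ennreal"
  assumes [measurable]: "h \<in> borel_measurable borel"
  shows "(\<integral>\<^sup>+y\<in>ball 0 R. h (x + y) \<partial>dunkl_borel (- 1 / 2)) \<le>
    (\<integral>\<^sup>+y\<in>ball 0 (R + \<bar>x\<bar>). h y \<partial>dunkl_borel (- 1 / 2))"
proof -
  define A where "A = dunkl_weight (- 1 / 2) 1"
  \<comment> \<open>At 0 the weight is 0 instead of A, since \<open>0 powr 0 = 0\<close>; the
    comparisons below are therefore made almost everywhere.\<close>
  have w: "dunkl_weight (- 1 / 2) y = A" if "y \<noteq> 0" for y
    using that by (simp add: A_def dunkl_weight_def)
  have "(\<integral>\<^sup>+y\<in>ball 0 R. h (x + y) \<partial>dunkl_borel (- 1 / 2)) =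
      (\<integral>\<^sup>+y. ennreal (dunkl_weight (- 1 / 2) y) * (h (x + y) * indicator (ball 0 R) y) \<partial>lborel)"
    by (rule nn_integral_dunkl_borel) measurable
  also have "\<dots> \<le> (\<integral>\<^sup>+y. ennreal A * (h (x + 1 * y) * indicator (ball 0 (R + \<bar>x\<bar>)) (x + 1 * y)) \<partial>lborel)"
  proof (rule nn_integral_mono_AE)
    show "AE y in lborel. ennreal (dunkl_weight (- 1 / 2) y) * (h (x + y) * indicator (ball 0 R) y) \<le>
        ennreal A * (h (x + 1 * y) * indicator (ball 0 (R + \<bar>x\<bar>)) (x + 1 * y))"
      using AE_lborel_singleton[of "0::real"]
    proof eventually_elim
      case (elim y)
      have "(indicator (ball 0 R) y :: ennreal) \<le> indicator (ball 0 (R + \<bar>x\<bar>)) (x + 1 * y)"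
        by (auto simp: indicator_def)
      then show ?case unfolding w[OF elim] by (simp add: mult_left_mono)
    qed
  qed
  also have "\<dots> = (\<integral>\<^sup>+y. ennreal A * (h y * indicator (ball 0 (R + \<bar>x\<bar>)) y) \<partial>lborel)"
    using nn_integral_real_affine[of "\<lambda>y. ennreal A * (h y * indicator (ball 0 (R + \<bar>x\<bar>)) y)" 1 x] by simp
  also have "\<dots> = (\<integral>\<^sup>+y. ennreal (dunkl_weight (- 1 / 2) y) * (h y * indicator (ball 0 (R + \<bar>x\<bar>)) y) \<partial>lborel)"
    by (rule nn_integral_cong_AE, use AE_lborel_singleton[of "0::real"] in eventually_elim)
       (simp only: w not_False_eq_True)
  also have "\<dots> = (\<integral>\<^sup>+y\<in>ball 0 (R + \<bar>x\<bar>). h y \<partial>dunkl_borel (- 1 / 2))"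
    by (rule nn_integral_dunkl_borel[symmetric]) measurable
  finally show ?thesis .
qed

section \<open>The translation kernel\<close>

text \<open>By the law of cosines \<open>dunkl_sigma x y z\<close> is, up to sign, the cosine of the
  angle between the sides |x| and |y| in a triangle with sides |x|, |y|, |z|.\<close>

lemma abs_dunkl_sigma_le:
  assumes "x \<noteq> 0" "y \<noteq> 0" "\<bar>\<bar>x\<bar> - \<bar>y\<bar>\<bar> \<le> \<bar>z\<bar>" "\<bar>z\<bar> \<le> \<bar>x\<bar> + \<bar>y\<bar>"
  shows "\<bar>dunkl_sigma x y z\<bar> \<le> 1"
proof -
  have "z\<^sup>2 \<le> (\<bar>x\<bar> + \<bar>y\<bar>)\<^sup>2"
    using assms(4) power_mono[of "\<bar>z\<bar>" "\<bar>x\<bar> + \<bar>y\<bar>" 2] by simp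
  moreover have "(\<bar>x\<bar> - \<bar>y\<bar>)\<^sup>2 \<le> z\<^sup>2"
    using assms(3) by (simp add: abs_le_square_iff)
  ultimately have "\<bar>x\<^sup>2 + y\<^sup>2 - z\<^sup>2\<bar> \<le> 2 * \<bar>x\<bar> * \<bar>y\<bar>"
    by (simp add: power2_sum power2_diff abs_le_iff)
  then show ?thesis
    using assms(1,2) by (simp add: dunkl_sigma_def abs_mult abs_divide divide_le_eq)
qed

lemma dunkl_kappa_nonneg:
  assumes "\<alpha> > - 1 / 2"
  shows "0 \<le> dunkl_kappa \<alpha> a b c"
  using assms by (simp add: dunkl_kappa_def Gamma_real_pos less_imp_le)

text \<open>The support condition of \<open>dunkl_kappa\<close> consists of the triangle
  inequalities, which are symmetric in the three sides, so each of the three cosines is at most 1 in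
  absolute value; 4 = 1 + 1 + 1 + 1.\<close>

lemma abs_dunkl_W_le:
  assumes "\<alpha> > - 1 / 2" "x \<noteq> 0" "y \<noteq> 0" "z \<noteq> 0"
  shows "\<bar>dunkl_W \<alpha> x y z\<bar> \<le> 4 * dunkl_kappa \<alpha> \<bar>x\<bar> \<bar>y\<bar> \<bar>z\<bar>"
proof (cases "\<bar>z\<bar> \<in> {\<bar>\<bar>x\<bar> - \<bar>y\<bar>\<bar> .. \<bar>x\<bar> + \<bar>y\<bar>}")
  case True
  then have tri: "\<bar>z\<bar> \<le> \<bar>x\<bar> + \<bar>y\<bar>" "\<bar>x\<bar> \<le> \<bar>y\<bar> + \<bar>z\<bar>" "\<bar>y\<bar> \<le> \<bar>x\<bar> + \<bar>z\<bar>"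
    unfolding atLeastAtMost_iff by linarith+
  have "\<bar>dunkl_sigma x y z\<bar> \<le> 1"
    by (rule abs_dunkl_sigma_le[OF assms(2,3)]) (use tri in linarith)+
  moreover have "\<bar>dunkl_sigma z x y\<bar> \<le> 1"
    by (rule abs_dunkl_sigma_le[OF assms(4,2)]) (use tri in linarith)+
  moreover have "\<bar>dunkl_sigma z y x\<bar> \<le> 1"
    by (rule abs_dunkl_sigma_le[OF assms(4,3)]) (use tri in linarith)+
  ultimately have "\<bar>1 - dunkl_sigma x y z + dunkl_sigma z x y + dunkl_sigma z y x\<bar> \<le> 4"
    by linarith
  then show ?thesis
    unfolding dunkl_W_def abs_mult
    using dunkl_kappa_nonneg[OF assms(1)] by (simp add: mult_right_mono)
next
  case False
  then have "dunkl_kappa \<alpha> \<bar>x\<bar> \<bar>y\<bar> \<bar>z\<bar> = 0"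
    unfolding dunkl_kappa_def by (simp only: if_False)
  then show ?thesis by (simp add: dunkl_W_def)
qed

lemma dunkl_W_support:
  assumes "dunkl_W \<alpha> x y z \<noteq> 0"
  shows "\<bar>z\<bar> \<le> \<bar>x\<bar> + \<bar>y\<bar>"
  using assms by (auto simp: dunkl_W_def dunkl_kappa_def split: if_splits)

text \<open>\<open>dunkl_sigma\<close> is homogeneous of degree 0. In \<open>dunkl_kappa\<close> the
  numerator has degree 4(\<alpha> - 1/2) and the denominator 6\<alpha>, so the kernel has degree
  -2\<alpha> - 2 = -d_\<alpha>, which the degree d_\<alpha> of the measure compensates.\<close>

lemma dunkl_W_scale:
  assumes t: "t \<noteq> 0"
  shows "dunkl_W \<alpha> (x / t) (y / t) (z / t) = \<bar>t\<bar> powr dunkl_dim \<alpha> * dunkl_W \<alpha> x y z"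
proof -
  have sigma: "dunkl_sigma (x / t) (y / t) (z / t) = dunkl_sigma x y z" for x y z
  proof -
    have "((x / t)\<^sup>2 + (y / t)\<^sup>2 - (z / t)\<^sup>2) / (2 * (x / t) * (y / t)) =
        ((x\<^sup>2 + y\<^sup>2 - z\<^sup>2) / t\<^sup>2) / ((2 * x * y) / t\<^sup>2)"
      by (simp add: power_divide add_divide_distrib diff_divide_distrib power2_eq_square)
    also have "\<dots> = (x\<^sup>2 + y\<^sup>2 - z\<^sup>2) / (2 * x * y)" using t by simp
    finally have eq: "((x / t)\<^sup>2 + (y / t)\<^sup>2 - (z / t)\<^sup>2) / (2 * (x / t) * (y / t)) =
        (x\<^sup>2 + y\<^sup>2 - z\<^sup>2) / (2 * x * y)" .
    show ?thesis
      unfolding dunkl_sigma_def by (rule if_cong[OF _ eq refl]) (use t in auto)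
  qed
  have kappa: "dunkl_kappa \<alpha> \<bar>x / t\<bar> \<bar>y / t\<bar> \<bar>z / t\<bar> =
      \<bar>t\<bar> powr dunkl_dim \<alpha> * dunkl_kappa \<alpha> \<bar>x\<bar> \<bar>y\<bar> \<bar>z\<bar>"
  proof -
    define s where "s = \<bar>t\<bar>"
    have s: "s > 0" using t by (simp add: s_def)
    define a b c where "a = \<bar>x\<bar>" "b = \<bar>y\<bar>" "c = \<bar>z\<bar>"
    have cond: "c / s \<in> {\<bar>a / s - b / s\<bar> .. a / s + b / s} \<longleftrightarrow> c \<in> {\<bar>a - b\<bar> .. a + b}"
    proof -
      have "a / s - b / s = (a - b) / s" "a / s + b / s = (a + b) / s"
        by (simp_all only: diff_divide_distrib add_divide_distrib)
      moreover have "\<bar>(a - b) / s\<bar> = \<bar>a - b\<bar> / s" using s by simp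
      moreover have "u / s \<le> v / s \<longleftrightarrow> u \<le> v" for u v
        using s by (simp add: divide_le_cancel)
      ultimately show ?thesis by (simp only: atLeastAtMost_iff)
    qed
    have "((a / s + b / s)\<^sup>2 - (c / s)\<^sup>2) * ((c / s)\<^sup>2 - (a / s - b / s)\<^sup>2) =
        s powr (-4) * (((a + b)\<^sup>2 - c\<^sup>2) * (c\<^sup>2 - (a - b)\<^sup>2))"
    proof -
      have p: "s powr (-4) = 1 / (s\<^sup>2 * s\<^sup>2)"
        using s by (simp add: powr_minus_divide flip: power_add)
      have e: "(a / s + b / s)\<^sup>2 - (c / s)\<^sup>2 = ((a + b)\<^sup>2 - c\<^sup>2) / s\<^sup>2"
        "(c / s)\<^sup>2 - (a / s - b / s)\<^sup>2 = (c\<^sup>2 - (a - b)\<^sup>2) / s\<^sup>2"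
        by (simp_all only: add_divide_distrib[symmetric] diff_divide_distrib[symmetric] power_divide)
      show ?thesis
        unfolding p e by simp
    qed
    then have num: "(((a / s + b / s)\<^sup>2 - (c / s)\<^sup>2) * ((c / s)\<^sup>2 - (a / s - b / s)\<^sup>2)) powr (\<alpha> - 1 / 2)
        = s powr (-4 * (\<alpha> - 1 / 2)) * (((a + b)\<^sup>2 - c\<^sup>2) * (c\<^sup>2 - (a - b)\<^sup>2)) powr (\<alpha> - 1 / 2)"
      using s by (simp add: powr_mult powr_powr)
    have "\<bar>a / s * (b / s) * (c / s)\<bar> = s powr (-3) * \<bar>a * b * c\<bar>"
    proof -
      have "s powr (-3) = 1 / s ^ 3"
        using s by (simp add: powr_minus_divide)
      then show ?thesis using s by (simp add: abs_mult power3_eq_cube)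
    qed
    then have den: "\<bar>a / s * (b / s) * (c / s)\<bar> powr (2 * \<alpha>) =
        s powr (-6 * \<alpha>) * \<bar>a * b * c\<bar> powr (2 * \<alpha>)"
      using s by (simp add: powr_mult powr_powr)
    have pw: "s powr (-4 * (\<alpha> - 1 / 2)) / s powr (-6 * \<alpha>) = s powr dunkl_dim \<alpha>"
      unfolding dunkl_dim_def by (simp only: powr_diff[symmetric]) (simp add: algebra_simps)
    have "dunkl_kappa \<alpha> (a / s) (b / s) (c / s) = s powr dunkl_dim \<alpha> * dunkl_kappa \<alpha> a b c"
    proof -
      have "G * (A * N / (B * P)) = A / B * (G * (N / P))" for G A N B P :: real
        by (simp add: mult_ac)
      then show ?thesis
        unfolding dunkl_kappa_def cond num den pw[symmetric]
        by (cases "c \<in> {\<bar>a - b\<bar>..a + b}") (simp_all only: if_True if_False mult_zero_right)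
    qed
    then show ?thesis by (simp add: a_b_c_def s_def abs_divide)
  qed
  show ?thesis
    unfolding dunkl_W_def sigma kappa by simp
qed

lemma measurable_dunkl_W [measurable (raw)]:
  assumes [measurable]: "f \<in> borel_measurable M" "g \<in> borel_measurable M" "h \<in> borel_measurable M"
  shows "(\<lambda>w. dunkl_W \<alpha> (f w) (g w) (h w)) \<in> borel_measurable M"
  unfolding dunkl_W_def dunkl_sigma_def dunkl_kappa_def atLeastAtMost_iff by measurable

section \<open>Integrating the kernel over its second argument\<close>

text \<open>The substitution s = A + (B - A)u leads to the Beta integral on [0,1]; the exponent
  2\<gamma> + 1 collects 2\<gamma> from the integrand and 1 from ds.\<close>

lemma nn_integral_Beta:
  fixes A B \<gamma> :: real
  assumes "A < B" "\<gamma> > - 1"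
  shows "(\<integral>\<^sup>+s. ennreal (((B - s) * (s - A)) powr \<gamma>) * indicator {A..B} s \<partial>lborel) =
    ennreal ((B - A) powr (2 * \<gamma> + 1) * Beta (\<gamma> + 1) (\<gamma> + 1))"
proof -
  define c where "c = B - A"
  have c: "c > 0" using assms by (simp add: c_def)
  have "(\<integral>\<^sup>+s. ennreal (((B - s) * (s - A)) powr \<gamma>) * indicator {A..B} s \<partial>lborel) =
     ennreal \<bar>c\<bar> * (\<integral>\<^sup>+u. ennreal (((B - (A + c * u)) * ((A + c * u) - A)) powr \<gamma>)
        * indicator {A..B} (A + c * u) \<partial>lborel)"
    using c by (intro nn_integral_real_affine) auto
  also have "(\<integral>\<^sup>+u. ennreal (((B - (A + c * u)) * ((A + c * u) - A)) powr \<gamma>)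
        * indicator {A..B} (A + c * u) \<partial>lborel) =
     (\<integral>\<^sup>+u. ennreal (c powr (2 * \<gamma>)) *
       (ennreal (u powr (\<gamma> + 1 - 1) * (1 - u) powr (\<gamma> + 1 - 1)) * indicator {0..1} u) \<partial>lborel)"
  proof (rule nn_integral_cong)
    fix u
    have i: "indicator {A..B} (A + c * u) = (indicator {0..1} u :: ennreal)"
    proof -
      have "A + c * u \<le> B \<longleftrightarrow> u \<le> 1" 
      proof -
        have "A + c * u \<le> A + c * 1 \<longleftrightarrow> u \<le> 1"
          using c by (simp only: add_le_cancel_left mult_le_cancel_left_pos)
        then show ?thesis by (simp add: c_def)
      qed
      moreover have "A \<le> A + c * u \<longleftrightarrow> 0 \<le> u" using c by (simp add: zero_le_mult_iff)
      ultimately show ?thesis by (simp add: indicator_def)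
    qed
    have "(B - (A + c * u)) * ((A + c * u) - A) = (c * c) * (u * (1 - u))"
      by (simp add: c_def algebra_simps)
    moreover have "c powr \<gamma> * c powr \<gamma> = c powr (2 * \<gamma>)"
      by (simp flip: powr_add)
    ultimately have "((B - (A + c * u)) * ((A + c * u) - A)) powr \<gamma> =
        c powr (2 * \<gamma>) * (u powr \<gamma> * (1 - u) powr \<gamma>)"
      by (simp only: powr_mult)
    then show "ennreal (((B - (A + c * u)) * ((A + c * u) - A)) powr \<gamma>)
        * indicator {A..B} (A + c * u) = ennreal (c powr (2 * \<gamma>)) *
       (ennreal (u powr (\<gamma> + 1 - 1) * (1 - u) powr (\<gamma> + 1 - 1)) * indicator {0..1} u)"
      unfolding i by (simp add: ennreal_mult mult.assoc)
  qed
  also have "\<dots> = ennreal (c powr (2 * \<gamma>)) * ennreal (Beta (\<gamma> + 1) (\<gamma> + 1))"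
  proof -
    have "((\<lambda>u. u powr (\<gamma> + 1 - 1) * (1 - u) powr (\<gamma> + 1 - 1)) has_integral
        Beta (\<gamma> + 1) (\<gamma> + 1)) {0..1}"
      using assms(2) by (intro has_integral_Beta_real) auto
    from nn_integral_has_integral_lebesgue'[OF _ this] show ?thesis
      by (subst nn_integral_cmult) auto
  qed
  also have "ennreal \<bar>c\<bar> * (ennreal (c powr (2 * \<gamma>)) * ennreal (Beta (\<gamma> + 1) (\<gamma> + 1))) =
      ennreal (c * (c powr (2 * \<gamma>) * Beta (\<gamma> + 1) (\<gamma> + 1)))"
    using c by (simp add: ennreal_mult')
  also have "c * (c powr (2 * \<gamma>) * Beta (\<gamma> + 1) (\<gamma> + 1)) =
      c powr (2 * \<gamma> + 1) * Beta (\<gamma> + 1) (\<gamma> + 1)"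
    using c by (simp add: powr_add)
  finally show ?thesis by (simp add: c_def)
qed

lemma nn_integral_abs_le:
  fixes g :: "real \<Rightarrow> ennreal"
  assumes [measurable]: "g \<in> borel_measurable borel"
  shows "(\<integral>\<^sup>+y. g \<bar>y\<bar> \<partial>lborel) \<le> 2 * (\<integral>\<^sup>+y. g y * indicator {0..} y \<partial>lborel)"
proof -
  \<comment> \<open>Both half-lines contain 0, so the sum only dominates.\<close>
  have "(\<integral>\<^sup>+y. g \<bar>y\<bar> \<partial>lborel) \<le>
     (\<integral>\<^sup>+y. g y * indicator {0..} y + g (- y) * indicator {0..} (- y) \<partial>lborel)"
    by (intro nn_integral_mono) (auto simp: indicator_def)
  also have "\<dots> = (\<integral>\<^sup>+y. g y * indicator {0..} y \<partial>lborel) +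
     (\<integral>\<^sup>+y. g (- y) * indicator {0..} (- y) \<partial>lborel)"
    by (intro nn_integral_add) auto
  also have "(\<integral>\<^sup>+y. g (- y) * indicator {0..} (- y) \<partial>lborel) =
     (\<integral>\<^sup>+y. g y * indicator {0..} y \<partial>lborel)"
    using nn_integral_real_affine[of "\<lambda>y. g y * indicator {0..} y" "-1" 0] by simp
  finally show ?thesis by (simp add: mult_2)
qed

text \<open>The product in \<open>dunkl_kappa\<close> is 16 times the squared area of the triangle
  (Heron), hence symmetric in the sides, and as a function of y it is (B - y^2)(y^2 - A). The weight
  y^(2\<alpha>+1) cancels y^(2\<alpha>) in the denominator and leaves y dy, so s = y^2 gives a Beta
  integral over an interval of length B - A = 4ac. The resulting (4ac)^(2\<alpha>) cancels
  (ac)^(2\<alpha>), which makes the bound free of a and c. Convergence at the endpoints requires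
  \<alpha> - 1/2 > -1. \<open>C\<close> is the product of the normalising constants D_\<alpha> and
  A_\<alpha>.\<close>

lemma nn_integral_dunkl_kappa_half:
  fixes \<alpha> a c :: real
  assumes \<alpha>: "\<alpha> > - 1 / 2" and a: "a > 0" and c: "c > 0"
  defines "C \<equiv> (Gamma (\<alpha> + 1))\<^sup>2 / (2 powr (\<alpha> - 1) * sqrt pi * Gamma (\<alpha> + 1 / 2)) *
    (1 / (2 powr (\<alpha> + 1) * Gamma (\<alpha> + 1)))"
  shows "(\<integral>\<^sup>+y. ennreal (dunkl_weight \<alpha> y * dunkl_kappa \<alpha> a y c) * indicator {0..} y \<partial>lborel)
    \<le> ennreal (C * 4 powr (2 * \<alpha>) * Beta (\<alpha> + 1 / 2) (\<alpha> + 1 / 2))"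
proof -
  define A B where "A = (a - c)\<^sup>2" and "B = (a + c)\<^sup>2"
  define D A' where "D = (Gamma (\<alpha> + 1))\<^sup>2 / (2 powr (\<alpha> - 1) * sqrt pi * Gamma (\<alpha> + 1 / 2))"
    and "A' = 1 / (2 powr (\<alpha> + 1) * Gamma (\<alpha> + 1))"
  have C_eq: "C = D * A'" by (simp only: C_def D_def A'_def)
  have C0: "C \<ge> 0" using \<alpha> by (simp add: C_def Gamma_real_pos less_imp_le)
  define h where "h s = ((B - s) * (s - A)) powr (\<alpha> - 1 / 2)" for s
  have [measurable]: "h \<in> borel_measurable borel" unfolding h_def by measurable
  define E where "E = C / (a * c) powr (2 * \<alpha>)"
  have E0: "E \<ge> 0" using C0 by (simp add: E_def)
  have BA: "B - A = 4 * (a * c)" by (simp add: A_def B_def power2_eq_square algebra_simps)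
  then have AB: "A < B" using a c by (metis diff_gt_0_iff_gt mult_pos_pos zero_less_numeral)
  have "(\<integral>\<^sup>+y. ennreal (dunkl_weight \<alpha> y * dunkl_kappa \<alpha> a y c) * indicator {0..} y \<partial>lborel)
    \<le> (\<integral>\<^sup>+y. ennreal E * (ennreal (h (y\<^sup>2) * (2 * y)) * indicator {\<bar>a - c\<bar>..a + c} y) \<partial>lborel)"
  proof (rule nn_integral_mono)
    fix y
    show "ennreal (dunkl_weight \<alpha> y * dunkl_kappa \<alpha> a y c) * indicator {0..} y \<le>
      ennreal E * (ennreal (h (y\<^sup>2) * (2 * y)) * indicator {\<bar>a - c\<bar>..a + c} y)"
    proof (cases "y > 0 \<and> c \<in> {\<bar>a - y\<bar>..a + y}")
      case True
      then have y: "y > 0" and mem: "y \<in> {\<bar>a - c\<bar>..a + c}" by auto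
      have "((a + y)\<^sup>2 - c\<^sup>2) * (c\<^sup>2 - (a - y)\<^sup>2) = (B - y\<^sup>2) * (y\<^sup>2 - A)"
        unfolding A_def B_def by algebra
      moreover have "\<bar>a * y * c\<bar> powr (2 * \<alpha>) = (a * c) powr (2 * \<alpha>) * y powr (2 * \<alpha>)"
        using a c y by (simp add: abs_mult powr_mult)
      ultimately have kappa: "dunkl_kappa \<alpha> a y c =
          D * (h (y\<^sup>2) / ((a * c) powr (2 * \<alpha>) * y powr (2 * \<alpha>)))"
        using True unfolding dunkl_kappa_def D_def h_def by simp
      have weight: "dunkl_weight \<alpha> y = A' * (y powr (2 * \<alpha>) * y)"
        using y unfolding dunkl_weight_def A'_def by (simp add: powr_add)
      have "dunkl_weight \<alpha> y * dunkl_kappa \<alpha> a y c = E * (h (y\<^sup>2) * y)"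
        unfolding weight kappa E_def C_eq using y by simp
      \<comment> \<open>A factor 2 is given away so that 2y is the derivative of y^2.\<close>
      also have "\<dots> \<le> E * (h (y\<^sup>2) * (2 * y))"
        using y E0 by (intro mult_left_mono) (auto simp: h_def)
      finally show ?thesis
        using mem E0 by (simp add: ennreal_leI indicator_def flip: ennreal_mult')
    next
      \<comment> \<open>The left-hand side is 0: negative y are cut off by the indicator, at y = 0
        the weight vanishes, and otherwise the kernel does.\<close>
      case False
      then show ?thesis
        by (auto simp: dunkl_kappa_def dunkl_weight_def indicator_def not_less)
    qed
  qed
  also have "\<dots> = ennreal E * (\<integral>\<^sup>+y. ennreal (h (y\<^sup>2) * (2 * y)) * indicator {\<bar>a - c\<bar>..a + c} y \<partial>lborel)"
    by (rule nn_integral_cmult) measurable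
  also have "(\<integral>\<^sup>+y. ennreal (h (y\<^sup>2) * (2 * y)) * indicator {\<bar>a - c\<bar>..a + c} y \<partial>lborel) =
     (\<integral>\<^sup>+s. ennreal (h s * indicator {\<bar>a - c\<bar>\<^sup>2..(a + c)\<^sup>2} s) \<partial>lborel)"
  proof -
    have "(\<integral>\<^sup>+s. ennreal (h s * indicator {\<bar>a - c\<bar>\<^sup>2..(a + c)\<^sup>2} s) \<partial>lborel) =
      (\<integral>\<^sup>+y. ennreal (h (y\<^sup>2) * (2 * y) * indicator {\<bar>a - c\<bar>..a + c} y) \<partial>lborel)"
    proof (rule nn_integral_substitution)
      show "set_borel_measurable borel {\<bar>a - c\<bar>\<^sup>2..(a + c)\<^sup>2} h"
        unfolding set_borel_measurable_def by measurable
      show "((\<lambda>y. y\<^sup>2) has_real_derivative 2 * y) (at y)" for y :: real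
        by (auto intro!: derivative_eq_intros)
    qed (use a c in \<open>auto intro!: continuous_intros\<close>)
    then show ?thesis by (simp add: ennreal_mult'' ennreal_indicator)
  qed
  also have "(\<integral>\<^sup>+s. ennreal (h s * indicator {\<bar>a - c\<bar>\<^sup>2..(a + c)\<^sup>2} s) \<partial>lborel) =
      (\<integral>\<^sup>+s. ennreal (h s) * indicator {A..B} s \<partial>lborel)"
    by (simp add: ennreal_mult'' ennreal_indicator A_def B_def)
  also have "\<dots> = ennreal ((B - A) powr (2 * (\<alpha> - 1 / 2) + 1) *
      Beta (\<alpha> - 1 / 2 + 1) (\<alpha> - 1 / 2 + 1))"
    unfolding h_def using \<alpha> by (intro nn_integral_Beta AB) simp
  also have "ennreal E * \<dots> =
      ennreal (E * ((4 * (a * c)) powr (2 * \<alpha>) * Beta (\<alpha> + 1 / 2) (\<alpha> + 1 / 2)))"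
    using E0 by (simp add: BA ennreal_mult' add.commute)
  also have "E * ((4 * (a * c)) powr (2 * \<alpha>) * Beta (\<alpha> + 1 / 2) (\<alpha> + 1 / 2)) =
      C * 4 powr (2 * \<alpha>) * Beta (\<alpha> + 1 / 2) (\<alpha> + 1 / 2)"
    using a c by (simp add: E_def powr_mult)
  finally show ?thesis .
qed

text \<open>Here x and z are fixed and y varies, in contrast to the integral over z that gives the
  total variation of \<nu>_{x,y}. The constant 8 D is 4 from the bound of |W| by 4 \<kappa> times 2
  for the two half-lines.\<close>

lemma nn_integral_dunkl_W_bounded:
  assumes \<alpha>: "\<alpha> > - 1 / 2"
  obtains C where "\<And>x z. x \<noteq> 0 \<Longrightarrow> z \<noteq> 0 \<Longrightarrow>
    (\<integral>\<^sup>+y. ennreal \<bar>dunkl_W \<alpha> x y z\<bar> \<partial>dunkl_borel \<alpha>) \<le> ennreal C"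
proof -
  define C where "C = (Gamma (\<alpha> + 1))\<^sup>2 / (2 powr (\<alpha> - 1) * sqrt pi * Gamma (\<alpha> + 1 / 2)) *
    (1 / (2 powr (\<alpha> + 1) * Gamma (\<alpha> + 1)))"
  define D where "D = C * 4 powr (2 * \<alpha>) * Beta (\<alpha> + 1 / 2) (\<alpha> + 1 / 2)"
  have \<alpha>': "\<alpha> \<ge> - 1 / 2" using \<alpha> by simp
  have "(\<integral>\<^sup>+y. ennreal \<bar>dunkl_W \<alpha> x y z\<bar> \<partial>dunkl_borel \<alpha>) \<le> ennreal (8 * D)"
    if x: "x \<noteq> 0" and z: "z \<noteq> 0" for x z
  proof -
    have [measurable]: "(\<lambda>y. dunkl_kappa \<alpha> \<bar>x\<bar> y \<bar>z\<bar>) \<in> borel_measurable borel"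
      unfolding dunkl_kappa_def atLeastAtMost_iff by measurable
    have "(\<integral>\<^sup>+y. ennreal \<bar>dunkl_W \<alpha> x y z\<bar> \<partial>dunkl_borel \<alpha>) =
      (\<integral>\<^sup>+y. ennreal (dunkl_weight \<alpha> y) * ennreal \<bar>dunkl_W \<alpha> x y z\<bar> \<partial>lborel)"
      by (rule nn_integral_dunkl_borel) measurable
    also have "\<dots> \<le> (\<integral>\<^sup>+y. ennreal 4 *
        ennreal (dunkl_weight \<alpha> \<bar>y\<bar> * dunkl_kappa \<alpha> \<bar>x\<bar> \<bar>y\<bar> \<bar>z\<bar>) \<partial>lborel)"
    proof (rule nn_integral_mono)
      fix y
      have "dunkl_weight \<alpha> y * \<bar>dunkl_W \<alpha> x y z\<bar> \<le>
          4 * (dunkl_weight \<alpha> \<bar>y\<bar> * dunkl_kappa \<alpha> \<bar>x\<bar> \<bar>y\<bar> \<bar>z\<bar>)"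
      proof (cases "y = 0")
        \<comment> \<open>\<open>abs_dunkl_W_le\<close> excludes y = 0, where the weight
          vanishes.\<close>
        case True
        then show ?thesis by (simp add: dunkl_weight_def)
      next
        case False
        have "dunkl_weight \<alpha> \<bar>y\<bar> = dunkl_weight \<alpha> y" by (simp add: dunkl_weight_def)
        then show ?thesis
          using mult_left_mono[OF abs_dunkl_W_le[OF \<alpha> x False z] dunkl_weight_nonneg[OF \<alpha>', of y]]
          by simp
      qed
      then have "ennreal (dunkl_weight \<alpha> y * \<bar>dunkl_W \<alpha> x y z\<bar>) \<le>
          ennreal (4 * (dunkl_weight \<alpha> \<bar>y\<bar> * dunkl_kappa \<alpha> \<bar>x\<bar> \<bar>y\<bar> \<bar>z\<bar>))"
        by (rule ennreal_leI)
      then show "ennreal (dunkl_weight \<alpha> y) * ennreal \<bar>dunkl_W \<alpha> x y z\<bar> \<le> ennreal 4 *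
        ennreal (dunkl_weight \<alpha> \<bar>y\<bar> * dunkl_kappa \<alpha> \<bar>x\<bar> \<bar>y\<bar> \<bar>z\<bar>)"
        by (simp only: ennreal_mult'[OF dunkl_weight_nonneg[OF \<alpha>', of y]] ennreal_mult'[OF zero_le_numeral])
    qed
    also have "\<dots> = 4 * (\<integral>\<^sup>+y. ennreal (dunkl_weight \<alpha> \<bar>y\<bar> * dunkl_kappa \<alpha> \<bar>x\<bar> \<bar>y\<bar> \<bar>z\<bar>) \<partial>lborel)"
      by (subst nn_integral_cmult) auto
    also have "\<dots> \<le> 4 * (2 * (\<integral>\<^sup>+y. ennreal (dunkl_weight \<alpha> y * dunkl_kappa \<alpha> \<bar>x\<bar> y \<bar>z\<bar>) *
        indicator {0..} y \<partial>lborel))"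
      by (intro mult_left_mono nn_integral_abs_le) auto
    also have "\<dots> \<le> 4 * (2 * ennreal D)"
      unfolding D_def C_def using x z
      by (intro mult_left_mono nn_integral_dunkl_kappa_half \<alpha>) auto
    also have "\<dots> = ennreal (8 * D)"
      by (simp add: ennreal_mult' mult.assoc[symmetric] numeral_mult_ennreal)
    finally show ?thesis .
  qed
  then show ?thesis using that by blast
qed

section \<open>The Campanato seminorm\<close>

lemma dunkl_translation_borel:
  assumes "\<alpha> \<ge> - 1 / 2" and [measurable]: "f \<in> borel_measurable borel"
  shows "dunkl_translation \<alpha> x f y =
     (if \<alpha> = - 1 / 2 then f (x + y)
      else if y = 0 then f x
      else if x = 0 then f y
      else (LINT z|dunkl_borel \<alpha>. dunkl_W \<alpha> x y z *\<^sub>R f z))"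
proof -
  have "(LINT z|dunkl_measure \<alpha>. dunkl_W \<alpha> x y z *\<^sub>R f z) =
      (LINT z|dunkl_borel \<alpha>. dunkl_W \<alpha> x y z *\<^sub>R f z)"
    by (rule integral_dunkl_measure[OF assms(1)]) measurable
  then show ?thesis unfolding dunkl_translation_def by simp
qed

text \<open>Arbitrary u and v are allowed in order to cover (t, y) \<mapsto> (x/t, y/t), where joint
  measurability is required.\<close>

lemma measurable_dunkl_translation:
  assumes "\<alpha> \<ge> - 1 / 2" and [measurable]: "f \<in> borel_measurable borel"
    and [measurable]: "u \<in> borel_measurable M" "v \<in> borel_measurable M"
  shows "(\<lambda>w. dunkl_translation \<alpha> (u w) f (v w)) \<in> borel_measurable M"
proof -
  interpret sigma_finite_measure "dunkl_borel \<alpha>" by (rule sigma_finite_dunkl_borel)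
  show ?thesis unfolding dunkl_translation_borel[OF assms(1,2)] by measurable
qed

lemma dunkl_mean_borel:
  assumes "\<alpha> \<ge> - 1 / 2" and "f \<in> borel_measurable borel"
  shows "dunkl_mean \<alpha> r f x =
    (LINT y:ball 0 r|dunkl_borel \<alpha>. dunkl_translation \<alpha> x f y) /\<^sub>R dunkl_vol \<alpha> r"
proof -
  have [measurable]: "(\<lambda>y. dunkl_translation \<alpha> x f y) \<in> borel_measurable borel"
    by (rule measurable_dunkl_translation[OF assms]) auto
  have "(LINT y:ball 0 r|dunkl_measure \<alpha>. dunkl_translation \<alpha> x f y) =
      (LINT y:ball 0 r|dunkl_borel \<alpha>. dunkl_translation \<alpha> x f y)"
    unfolding set_lebesgue_integral_def
    by (rule integral_dunkl_measure[OF assms(1)]) measurable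
  then show ?thesis
    unfolding dunkl_mean_def by (simp add: measure_dunkl_measure_ball[OF assms(1)])
qed

lemma nn_integral_ball_dunkl_measure:
  assumes [measurable]: "g \<in> borel_measurable borel"
  shows "(\<integral>\<^sup>+y\<in>ball 0 r. g y \<partial>dunkl_measure \<alpha>) = (\<integral>\<^sup>+y\<in>ball 0 r. g y \<partial>dunkl_borel \<alpha>)"
  by (rule nn_integral_dunkl_measure) measurable

section \<open>The seminorm as a family of p-th power bounds\<close>

text \<open>Removes the p-th root and the division by the volume, so that the seminorm can be
  handled through plain integrals of p-th powers. If I is infinite, both sides fail.\<close>

lemma ennreal_power_le_iff:
  assumes p: "0 < p" and N: "0 \<le> N" and V: "0 < V" and c: "0 < c"
  shows "ennreal c * ennreal_power (I / ennreal V) (1 / p) \<le> ennreal N \<longleftrightarrow>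
    I \<le> ennreal (V * (N / c) powr p)"
proof (cases "I = \<infinity>")
  case True
  then have "I / ennreal V = \<infinity>" by (simp add: ennreal_top_divide)
  then show ?thesis using True c by (simp add: ennreal_power_def ennreal_mult_top top_unique)
next
  case False
  then obtain i where i: "I = ennreal i" "0 \<le> i" by (cases I) auto
  then have "I / ennreal V = ennreal (i / V)" using V by (simp add: divide_ennreal)
  then have "ennreal c * ennreal_power (I / ennreal V) (1 / p) = ennreal (c * (i / V) powr (1 / p))"
    using i V c by (simp add: ennreal_power_def ennreal_mult)
  then have "ennreal c * ennreal_power (I / ennreal V) (1 / p) \<le> ennreal N \<longleftrightarrow>
      c * (i / V) powr (1 / p) \<le> N"
    using N by simp
  also have "\<dots> \<longleftrightarrow> (i / V) powr (1 / p) \<le> N / c" using c by (simp add: field_simps)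
  also have "\<dots> \<longleftrightarrow> i / V \<le> (N / c) powr p"
  proof
    assume "(i / V) powr (1 / p) \<le> N / c"
    then have "((i / V) powr (1 / p)) powr p \<le> (N / c) powr p"
      using p by (intro powr_mono2) auto
    then show "i / V \<le> (N / c) powr p" using p i V by (simp add: powr_powr)
  next
    assume "i / V \<le> (N / c) powr p"
    then have "(i / V) powr (1 / p) \<le> ((N / c) powr p) powr (1 / p)"
      using p i V by (intro powr_mono2) auto
    then show "(i / V) powr (1 / p) \<le> N / c" using p N c by (simp add: powr_powr)
  qed
  also have "\<dots> \<longleftrightarrow> i \<le> V * (N / c) powr p" using V by (simp add: field_simps)
  also have "\<dots> \<longleftrightarrow> I \<le> ennreal (V * (N / c) powr p)"
    using i V by (simp add: ennreal_le_iff)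
  finally show ?thesis .
qed

lemma campanato_norm_le_iff:
  assumes \<alpha>: "\<alpha> \<ge> - 1 / 2" and f: "f \<in> borel_measurable borel" and p: "0 < p" and N: "0 \<le> N"
  shows "campanato_norm \<alpha> p q f \<le> ennreal N \<longleftrightarrow>
    (\<forall>r>0. \<forall>x. (\<integral>\<^sup>+y\<in>ball 0 r. ennreal (norm (dunkl_translation \<alpha> x f y - dunkl_mean \<alpha> r f x) powr p)
        \<partial>dunkl_borel \<alpha>) \<le> ennreal (dunkl_vol \<alpha> r * (N / r powr (dunkl_dim \<alpha> / q)) powr p))"
proof -
  have [measurable]: "(\<lambda>y. dunkl_translation \<alpha> x f y) \<in> borel_measurable borel" for x
    by (rule measurable_dunkl_translation[OF \<alpha> f]) auto
  have *: "(\<integral>\<^sup>+y\<in>ball 0 r. ennreal (norm (dunkl_translation \<alpha> x f y - dunkl_mean \<alpha> r f x) powr p)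
        \<partial>dunkl_measure \<alpha>) =
     (\<integral>\<^sup>+y\<in>ball 0 r. ennreal (norm (dunkl_translation \<alpha> x f y - dunkl_mean \<alpha> r f x) powr p)
        \<partial>dunkl_borel \<alpha>)" for r x
    by (rule nn_integral_ball_dunkl_measure) measurable
  show ?thesis
    unfolding campanato_norm_def SUP_le_iff * emeasure_dunkl_measure_ball[OF \<alpha>]
    using ennreal_power_le_iff[OF p N emeasure_dunkl_borel_ball(2)[OF \<alpha>]]
    by (auto simp: Ball_def)
qed

section \<open>Invariance under changes on null sets\<close>

text \<open>Where the translation is an integral in z, it does not see null sets at all; exceptional
  y arise only in the branches that evaluate f at a point (y = 0, x = 0, or \<alpha> =
  -1/2).\<close>

lemma dunkl_translation_cong_AE:
  assumes \<alpha>: "\<alpha> \<ge> - 1 / 2" and g: "g \<in> borel_measurable borel"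
    and fg: "AE x in lborel. f x = g x"
  shows "AE y in lborel. dunkl_translation \<alpha> x f y = dunkl_translation \<alpha> x g y"
proof (cases "\<alpha> = - 1 / 2")
  case True
  have "AE y in lborel. f (x + y) = g (x + y)"
  proof -
    obtain N where N: "\<And>x. x \<notin> N \<Longrightarrow> f x = g x" "N \<in> null_sets lborel"
      by (rule AE_E3[OF fg], rule that) simp_all
    have [measurable]: "N \<in> sets borel" using N(2) by (auto simp: null_sets_def)
    have "(\<integral>\<^sup>+y. indicator N (x + 1 * y) \<partial>lborel) = (\<integral>\<^sup>+y. indicator N y \<partial>lborel)"
      using nn_integral_real_affine[of "indicator N" 1 x] by simp
    also have "\<dots> = 0" using N(2) by (auto simp: null_sets_def)
    finally have "AE y in lborel. indicator N (x + y) = (0 :: ennreal)"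
      by (subst (asm) nn_integral_0_iff_AE) auto
    then show ?thesis
      by eventually_elim (use N(1) in \<open>simp add: indicator_eq_0_iff\<close>)
  qed
  then show ?thesis by (simp add: dunkl_translation_def True)
next
  case False
  have fm: "f \<in> borel_measurable lebesgue" by (rule measurable_lebesgue_AE[OF g fg])
  have [measurable]: "f \<in> borel_measurable (dunkl_measure \<alpha>)" "g \<in> borel_measurable (dunkl_measure \<alpha>)"
    using fm g by (auto simp: borel_measurable_dunkl_measure intro: measurable_completion)
  have [measurable]: "dunkl_W \<alpha> x y \<in> borel_measurable (dunkl_measure \<alpha>)" for y
    unfolding borel_measurable_dunkl_measure by (rule measurable_completion) measurable
  have "(LINT z|dunkl_measure \<alpha>. dunkl_W \<alpha> x y z *\<^sub>R f z) =
      (LINT z|dunkl_measure \<alpha>. dunkl_W \<alpha> x y z *\<^sub>R g z)" for y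
  proof (rule integral_cong_AE)
    have "AE z in dunkl_measure \<alpha>. f z = g z"
      using fg by (simp add: AE_dunkl_measure_iff[OF \<alpha>])
    then show "AE z in dunkl_measure \<alpha>. dunkl_W \<alpha> x y z *\<^sub>R f z = dunkl_W \<alpha> x y z *\<^sub>R g z"
      by eventually_elim simp
  qed measurable
  note eq = this
  from fg AE_lborel_singleton[of "0::real"] show ?thesis
    by eventually_elim (simp only: dunkl_translation_def False eq if_False split: if_split)
qed

text \<open>Lets Borel functions stand in for f and for its image under the operator, which is known
  only almost everywhere.\<close>

lemma campanato_norm_cong_AE:
  assumes \<alpha>: "\<alpha> \<ge> - 1 / 2" and g: "g \<in> borel_measurable borel"
    and fg: "AE x in lborel. f x = g x"
  shows "campanato_norm \<alpha> p q f = campanato_norm \<alpha> p q g"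
proof -
  have tr: "AE y in dunkl_measure \<alpha>. dunkl_translation \<alpha> x f y = dunkl_translation \<alpha> x g y" for x
    using dunkl_translation_cong_AE[OF assms] by (simp add: AE_dunkl_measure_iff[OF \<alpha>])
  have tg: "(\<lambda>y. dunkl_translation \<alpha> x g y) \<in> borel_measurable borel" for x
    by (rule measurable_dunkl_translation[OF \<alpha> g]) auto
  have tf: "dunkl_translation \<alpha> x f \<in> borel_measurable lebesgue" for x
    by (rule measurable_lebesgue_AE[OF tg dunkl_translation_cong_AE[OF assms]])
  have [measurable]: "dunkl_translation \<alpha> x f \<in> borel_measurable (dunkl_measure \<alpha>)"
    "dunkl_translation \<alpha> x g \<in> borel_measurable (dunkl_measure \<alpha>)" for x
    using tf tg by (auto simp: borel_measurable_dunkl_measure intro: measurable_completion)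
  have [measurable]: "ball 0 r \<in> sets (dunkl_measure \<alpha>)" for r
    by (simp add: sets_dunkl_measure)
  have mean: "dunkl_mean \<alpha> r f x = dunkl_mean \<alpha> r g x" for r x
  proof -
    have "(LINT y:ball 0 r|dunkl_measure \<alpha>. dunkl_translation \<alpha> x f y) =
      (LINT y:ball 0 r|dunkl_measure \<alpha>. dunkl_translation \<alpha> x g y)"
      unfolding set_lebesgue_integral_def
      by (rule integral_cong_AE) (use tr[of x] in \<open>auto elim!: eventually_mono\<close>)
    then show ?thesis by (simp add: dunkl_mean_def)
  qed
  have "(\<integral>\<^sup>+y\<in>ball 0 r. ennreal (norm (dunkl_translation \<alpha> x f y - dunkl_mean \<alpha> r f x) powr p)
      \<partial>dunkl_measure \<alpha>) =
    (\<integral>\<^sup>+y\<in>ball 0 r. ennreal (norm (dunkl_translation \<alpha> x g y - dunkl_mean \<alpha> r g x) powr p)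
      \<partial>dunkl_measure \<alpha>)" for r x
    unfolding mean by (rule nn_integral_cong_AE) (use tr[of x] in \<open>auto elim!: eventually_mono\<close>)
  then show ?thesis unfolding campanato_norm_def by simp
qed

text \<open>A compact set lies in a centred ball, and each centred ball lies in a compact
  one.\<close>

lemma locally_p_integrable_iff:
  assumes \<alpha>: "\<alpha> \<ge> - 1 / 2" and g: "g \<in> borel_measurable borel"
    and fg: "AE x in lborel. f x = g x"
  shows "locally_p_integrable \<alpha> p f \<longleftrightarrow>
    (\<forall>r>0. (\<integral>\<^sup>+x\<in>ball 0 r. ennreal (norm (g x) powr p) \<partial>dunkl_borel \<alpha>) < \<infinity>)"
proof -
  note g[measurable]
  have eq: "(\<integral>\<^sup>+x\<in>C. ennreal (norm (f x) powr p) \<partial>dunkl_measure \<alpha>) =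
      (\<integral>\<^sup>+x\<in>C. ennreal (norm (g x) powr p) \<partial>dunkl_borel \<alpha>)" if [measurable]: "C \<in> sets borel" for C
  proof -
    have "AE x in dunkl_measure \<alpha>. f x = g x" using fg by (simp add: AE_dunkl_measure_iff[OF \<alpha>])
    then have "(\<integral>\<^sup>+x\<in>C. ennreal (norm (f x) powr p) \<partial>dunkl_measure \<alpha>) =
      (\<integral>\<^sup>+x\<in>C. ennreal (norm (g x) powr p) \<partial>dunkl_measure \<alpha>)"
      by (intro nn_integral_cong_AE) (auto elim!: eventually_mono)
    also have "\<dots> = (\<integral>\<^sup>+x\<in>C. ennreal (norm (g x) powr p) \<partial>dunkl_borel \<alpha>)"
      by (rule nn_integral_dunkl_measure) measurable
    finally show ?thesis .
  qed
  have "f \<in> borel_measurable (dunkl_measure \<alpha>)"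
    using measurable_lebesgue_AE[OF g fg] by (simp add: borel_measurable_dunkl_measure)
  moreover have "(\<forall>C. compact C \<longrightarrow> (\<integral>\<^sup>+x\<in>C. ennreal (norm (f x) powr p) \<partial>dunkl_measure \<alpha>) < \<infinity>) \<longleftrightarrow>
    (\<forall>r>0. (\<integral>\<^sup>+x\<in>ball 0 r. ennreal (norm (g x) powr p) \<partial>dunkl_borel \<alpha>) < \<infinity>)"
  proof safe
    fix r :: real
    assume *: "\<forall>C. compact C \<longrightarrow> (\<integral>\<^sup>+x\<in>C. ennreal (norm (f x) powr p) \<partial>dunkl_measure \<alpha>) < \<infinity>"
    have "(\<integral>\<^sup>+x\<in>ball 0 r. ennreal (norm (g x) powr p) \<partial>dunkl_borel \<alpha>) \<le>
      (\<integral>\<^sup>+x\<in>cball 0 r. ennreal (norm (g x) powr p) \<partial>dunkl_borel \<alpha>)"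
      by (intro nn_integral_mono mult_left_mono) (auto simp: indicator_def)
    also have "\<dots> < \<infinity>" using * by (simp add: eq[symmetric] del: mem_cball)
    finally show "(\<integral>\<^sup>+x\<in>ball 0 r. ennreal (norm (g x) powr p) \<partial>dunkl_borel \<alpha>) < \<infinity>" .
  next
    fix C :: "real set"
    assume *: "\<forall>r>0. (\<integral>\<^sup>+x\<in>ball 0 r. ennreal (norm (g x) powr p) \<partial>dunkl_borel \<alpha>) < \<infinity>"
      and C: "compact C"
    obtain r where r: "r > 0" "C \<subseteq> ball 0 r"
      using compact_imp_bounded[OF C] by (meson bounded_subset_ballD)
    have "(\<integral>\<^sup>+x\<in>C. ennreal (norm (g x) powr p) \<partial>dunkl_borel \<alpha>) \<le>
      (\<integral>\<^sup>+x\<in>ball 0 r. ennreal (norm (g x) powr p) \<partial>dunkl_borel \<alpha>)"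
      using r(2) by (intro nn_integral_mono mult_left_mono) (auto simp: indicator_def)
    also have "\<dots> < \<infinity>" using * r(1) by blast
    finally show "(\<integral>\<^sup>+x\<in>C. ennreal (norm (f x) powr p) \<partial>dunkl_measure \<alpha>) < \<infinity>"
      using C by (simp add: eq compact_imp_closed borel_closed)
  qed
  ultimately show ?thesis unfolding locally_p_integrable_def by simp
qed

section \<open>Morrey decomposition of Campanato functions\<close>

lemma nn_integral_norm_add_powr_le:
  fixes u v :: "real \<Rightarrow> complex"
  assumes [measurable]: "u \<in> borel_measurable borel" "v \<in> borel_measurable borel" "S \<in> sets borel"
    and p: "0 \<le> p"
  shows "(\<integral>\<^sup>+y\<in>S. ennreal (norm (u y + v y) powr p) \<partial>dunkl_borel \<alpha>) \<le>
    ennreal (2 powr p) * ((\<integral>\<^sup>+y\<in>S. ennreal (norm (u y) powr p) \<partial>dunkl_borel \<alpha>) +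
      (\<integral>\<^sup>+y\<in>S. ennreal (norm (v y) powr p) \<partial>dunkl_borel \<alpha>))"
proof -
  have "(\<integral>\<^sup>+y\<in>S. ennreal (norm (u y + v y) powr p) \<partial>dunkl_borel \<alpha>) \<le>
    (\<integral>\<^sup>+y. ennreal (2 powr p) * (ennreal (norm (u y) powr p) * indicator S y +
       ennreal (norm (v y) powr p) * indicator S y) \<partial>dunkl_borel \<alpha>)"
  proof (rule nn_integral_mono)
    fix y
    have "ennreal (norm (u y + v y) powr p) \<le> ennreal (2 powr p * (norm (u y) powr p + norm (v y) powr p))"
      by (rule ennreal_leI[OF norm_add_powr_le[OF p]])
    also have "\<dots> = ennreal (2 powr p) * (ennreal (norm (u y) powr p) + ennreal (norm (v y) powr p))"
      by (subst ennreal_mult') auto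
    finally show "ennreal (norm (u y + v y) powr p) * indicator S y \<le>
       ennreal (2 powr p) * (ennreal (norm (u y) powr p) * indicator S y +
       ennreal (norm (v y) powr p) * indicator S y)"
      by (simp add: indicator_def)
  qed
  also have "\<dots> = ennreal (2 powr p) * ((\<integral>\<^sup>+y\<in>S. ennreal (norm (u y) powr p) \<partial>dunkl_borel \<alpha>) +
      (\<integral>\<^sup>+y\<in>S. ennreal (norm (v y) powr p) \<partial>dunkl_borel \<alpha>))"
    by (subst nn_integral_cmult; (subst nn_integral_add)?) auto
  finally show ?thesis .
qed

lemma nn_integral_ball_const:
  assumes \<alpha>: "\<alpha> \<ge> - 1 / 2" and "0 \<le> a"
  shows "(\<integral>\<^sup>+y\<in>ball 0 r. ennreal a \<partial>dunkl_borel \<alpha>) = ennreal (dunkl_vol \<alpha> r * a)"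
proof -
  have "(\<integral>\<^sup>+y\<in>ball 0 r. ennreal a \<partial>dunkl_borel \<alpha>) = ennreal a * emeasure (dunkl_borel \<alpha>) (ball 0 r)"
    by (rule nn_integral_cmult_indicator) simp
  also have "\<dots> = ennreal (a * dunkl_vol \<alpha> r)"
    using assms by (simp add: emeasure_dunkl_borel_ball(1)[OF \<alpha>] ennreal_mult')
  finally show ?thesis by (simp only: mult.commute)
qed

lemma nn_integral_ball_mono:
  fixes h :: "real \<Rightarrow> ennreal"
  assumes "r \<le> s"
  shows "(\<integral>\<^sup>+y\<in>ball 0 r. h y \<partial>M) \<le> (\<integral>\<^sup>+y\<in>ball 0 s. h y \<partial>M)"
  using assms by (intro nn_integral_mono mult_left_mono) (auto simp: indicator_def)

text \<open>Both numbers are compared with f on the smaller ball: m(r) through the bound on B(0,r),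
  and m(s) through the bound on B(0,s), whose volume is at most 2^d_\<alpha> times that of
  B(0,r).\<close>

lemma doubling_mean_diff:
  fixes f :: "real \<Rightarrow> complex"
  assumes \<alpha>: "\<alpha> \<ge> - 1 / 2" and [measurable]: "f \<in> borel_measurable borel" and p: "1 \<le> p" and e: "0 < e"
    and N: "0 \<le> N"
    and bound: "\<And>r. 0 < r \<Longrightarrow> (\<integral>\<^sup>+y\<in>ball 0 r. ennreal (norm (f y - m r) powr p) \<partial>dunkl_borel \<alpha>)
      \<le> ennreal (dunkl_vol \<alpha> r * (N / r powr e) powr p)"
  obtains C where "0 \<le> C" "\<And>r s. 0 < r \<Longrightarrow> r \<le> s \<Longrightarrow> s \<le> 2 * r \<Longrightarrow> norm (m r - m s) \<le> C / r powr e"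
proof
  \<comment> \<open>The factor 2^p comes from the triangle inequality for p-th powers, 1 from the
    bound on B(0,r), and 2^d_\<alpha> from doubling.\<close>
  define A where "A = 2 powr p * (1 + 2 powr dunkl_dim \<alpha>)"
  have A0: "A \<ge> 0" by (simp add: A_def)
  show "0 \<le> A powr (1 / p) * N" using N by simp
  fix r s :: real
  assume rs: "0 < r" "r \<le> s" "s \<le> 2 * r"
  have d0: "dunkl_dim \<alpha> \<ge> 0" using \<alpha> by (simp add: dunkl_dim_def)
  have Vr: "dunkl_vol \<alpha> r > 0" by (rule emeasure_dunkl_borel_ball(2)[OF \<alpha> rs(1)])
  have Vs: "dunkl_vol \<alpha> s \<le> 2 powr dunkl_dim \<alpha> * dunkl_vol \<alpha> r"
  proof -
    have "s powr dunkl_dim \<alpha> \<le> (2 * r) powr dunkl_dim \<alpha>"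
      using rs d0 by (intro powr_mono2) auto
    then have "dunkl_vol \<alpha> 1 * s powr dunkl_dim \<alpha> \<le> dunkl_vol \<alpha> 1 * (2 powr dunkl_dim \<alpha> * r powr dunkl_dim \<alpha>)"
      using emeasure_dunkl_borel_ball(2)[OF \<alpha>, of 1] by (simp add: powr_mult)
    then show ?thesis
      using emeasure_dunkl_borel_ball(4)[OF \<alpha>, of r] emeasure_dunkl_borel_ball(4)[OF \<alpha>, of s] rs
      by (simp add: mult_ac)
  qed
  define H where "H = (N / r powr e) powr p"
  have H0: "H \<ge> 0" by (simp add: H_def)
  have Hs: "(N / s powr e) powr p \<le> H"
    unfolding H_def using rs N p e
    by (intro powr_mono2 divide_left_mono) (auto intro!: powr_mono2)
  have "ennreal (dunkl_vol \<alpha> r * norm (m r - m s) powr p) =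
      (\<integral>\<^sup>+y\<in>ball 0 r. ennreal (norm ((m r - f y) + (f y - m s)) powr p) \<partial>dunkl_borel \<alpha>)"
    by (simp add: nn_integral_ball_const[OF \<alpha>])
  also have "\<dots> \<le> ennreal (2 powr p) * ((\<integral>\<^sup>+y\<in>ball 0 r. ennreal (norm (m r - f y) powr p) \<partial>dunkl_borel \<alpha>) +
      (\<integral>\<^sup>+y\<in>ball 0 r. ennreal (norm (f y - m s) powr p) \<partial>dunkl_borel \<alpha>))"
    by (rule nn_integral_norm_add_powr_le) (use p in auto)
  also have "\<dots> \<le> ennreal (2 powr p) * (ennreal (dunkl_vol \<alpha> r * H) +
      ennreal (dunkl_vol \<alpha> s * (N / s powr e) powr p))"
  proof (intro mult_left_mono add_mono)
    show "(\<integral>\<^sup>+y\<in>ball 0 r. ennreal (norm (m r - f y) powr p) \<partial>dunkl_borel \<alpha>) \<le> ennreal (dunkl_vol \<alpha> r * H)"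
      using bound[OF rs(1)] by (simp add: norm_minus_commute H_def)
    show "(\<integral>\<^sup>+y\<in>ball 0 r. ennreal (norm (f y - m s) powr p) \<partial>dunkl_borel \<alpha>) \<le>
        ennreal (dunkl_vol \<alpha> s * (N / s powr e) powr p)"
      by (rule order_trans[OF nn_integral_ball_mono[OF rs(2)] bound]) (use rs in simp)
  qed simp
  also have "\<dots> \<le> ennreal (2 powr p) * (ennreal (dunkl_vol \<alpha> r * H) +
      ennreal (2 powr dunkl_dim \<alpha> * dunkl_vol \<alpha> r * H))"
    using Hs Vs Vr H0 by (intro mult_left_mono add_left_mono ennreal_leI mult_mono) auto
  also have "\<dots> = ennreal (dunkl_vol \<alpha> r * (A * H))"
    using Vr H0 by (simp add: A_def algebra_simps flip: ennreal_plus ennreal_mult')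
  finally have "dunkl_vol \<alpha> r * norm (m r - m s) powr p \<le> dunkl_vol \<alpha> r * (A * H)"
    using Vr A0 H0 by (subst (asm) ennreal_le_iff) auto
  then have "norm (m r - m s) powr p \<le> A * H" using Vr by simp
  then have "(norm (m r - m s) powr p) powr (1 / p) \<le> (A * H) powr (1 / p)"
    using p by (intro powr_mono2) auto
  also have "(norm (m r - m s) powr p) powr (1 / p) = norm (m r - m s)"
    using p by (simp add: powr_powr)
  also have "(A * H) powr (1 / p) = A powr (1 / p) * N / r powr e"
    using p N rs by (simp add: powr_mult H_def powr_powr)
  finally show "norm (m r - m s) \<le> A powr (1 / p) * N / r powr e" .
qed

text \<open>Telescoping over r, 2r, 4r, ...: the increments C/(2^j r)^e form a convergent geometric
  series because e > 0, which is where q < \<infinity> enters.\<close>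

lemma dyadic_chain:
  fixes m :: "real \<Rightarrow> complex"
  assumes e: "0 < e" and C: "0 \<le> C"
    and step: "\<And>r s. 0 < r \<Longrightarrow> r \<le> s \<Longrightarrow> s \<le> 2 * r \<Longrightarrow> norm (m r - m s) \<le> C / r powr e"
  obtains L where "0 \<le> L" "\<And>r s. 0 < r \<Longrightarrow> r \<le> s \<Longrightarrow> norm (m r - m s) \<le> L / r powr e"
proof
  define u where "u = 1 / 2 powr e"
  have u: "0 < u" "u < 1" using e powr_less_mono[of 0 e 2] by (simp_all add: u_def)
  \<comment> \<open>The fixed point of L = C + u L, so that one doubling step reproduces the bound
    with the same L.\<close>
  define L where "L = C / (1 - u)"
  have L: "L = C + u * L" using u by (simp add: L_def field_simps)
  show L0: "0 \<le> L" using u C by (simp add: L_def)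
  have CL: "C \<le> L" using L u L0 by (smt (verit) mult_nonneg_nonneg)
  have chain: "norm (m r - m s) \<le> L / r powr e" if "0 < r" "r \<le> s" "s \<le> 2 ^ n * r" for r s and n :: nat
    using that
  proof (induction n arbitrary: r)
    case 0
    then show ?case using L0 by simp
  next
    case (Suc n)
    show ?case
    proof (cases "s \<le> 2 * r")
      case True
      have "norm (m r - m s) \<le> C / r powr e" using Suc.prems True by (intro step) auto
      also have "\<dots> \<le> L / r powr e" using CL by (intro divide_right_mono) auto
      finally show ?thesis .
    next
      case False
      have "norm (m r - m s) \<le> norm (m r - m (2 * r)) + norm (m (2 * r) - m s)"
        using norm_triangle_ineq[of "m r - m (2 * r)" "m (2 * r) - m s"] by simp
      also have "\<dots> \<le> C / r powr e + L / (2 * r) powr e"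
        using Suc.prems False by (intro add_mono step Suc.IH) (auto simp: mult_ac)
      also have "L / (2 * r) powr e = u * L / r powr e" by (simp add: powr_mult u_def)
      also have "C / r powr e + u * L / r powr e = L / r powr e"
        by (subst (2) L) (simp add: add_divide_distrib)
      finally show ?thesis .
    qed
  qed
  fix r s :: real
  assume rs: "0 < r" "r \<le> s"
  obtain n :: nat where "s / r < 2 ^ n" using real_arch_pow[of 2 "s / r"] by auto
  then have "s \<le> 2 ^ n * r" using rs by (simp add: field_simps)
  then show "norm (m r - m s) \<le> L / r powr e" using chain rs by blast
qed

text \<open>A Campanato function of exponent \<open>q < \<infinity>\<close> differs from a Morrey function by a constant,
  the limit of its means over growing balls.\<close>

lemma morrey_decomposition:
  fixes f :: "real \<Rightarrow> complex"
  assumes \<alpha>: "\<alpha> \<ge> - 1 / 2" and f [measurable]: "f \<in> borel_measurable borel"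
    and p: "1 \<le> p" and e: "0 < e" and N: "0 \<le> N"
    and bound: "\<And>r. 0 < r \<Longrightarrow> (\<integral>\<^sup>+y\<in>ball 0 r. ennreal (norm (f y - m r) powr p) \<partial>dunkl_borel \<alpha>)
      \<le> ennreal (dunkl_vol \<alpha> r * (N / r powr e) powr p)"
  obtains c M where "0 \<le> M"
    "\<And>r. 0 < r \<Longrightarrow> (\<integral>\<^sup>+y\<in>ball 0 r. ennreal (norm (f y - c) powr p) \<partial>dunkl_borel \<alpha>)
      \<le> ennreal (dunkl_vol \<alpha> r * (M / r powr e) powr p)"
proof -
  obtain C where "0 \<le> C" "\<And>r s. 0 < r \<Longrightarrow> r \<le> s \<Longrightarrow> s \<le> 2 * r \<Longrightarrow> norm (m r - m s) \<le> C / r powr e"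
    using doubling_mean_diff[OF \<alpha> f p e N bound] by blast
  then obtain L where L: "0 \<le> L" "\<And>r s. 0 < r \<Longrightarrow> r \<le> s \<Longrightarrow> norm (m r - m s) \<le> L / r powr e"
    using dyadic_chain[OF e] by blast
  have lim0: "((\<lambda>r. L / r powr e) \<longlongrightarrow> 0) at_top"
    using tendsto_mult_right_zero[OF tendsto_neg_powr[OF _ filterlim_ident], of "- e" L] e
    by (simp add: powr_minus_divide)
  \<comment> \<open>Integer radii give a sequence, and \<open>Suc\<close> keeps them positive;
    \<open>mc\<close> below then handles every radius.\<close>
  have "Cauchy (\<lambda>n. m (real (Suc n)))"
  proof (rule metric_CauchyI)
    fix \<epsilon> :: real assume "0 < \<epsilon>"
    then have "eventually (\<lambda>r. L / r powr e < \<epsilon> / 2) at_top"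
      by (intro order_tendstoD(2)[OF lim0]) auto
    then obtain R where R: "\<And>r. R \<le> r \<Longrightarrow> L / r powr e < \<epsilon> / 2"
      by (auto simp: eventually_at_top_linorder)
    define n0 where "n0 = nat \<lceil>R\<rceil>"
    have near: "dist (m (real (Suc n0))) (m (real (Suc n))) < \<epsilon> / 2" if "n0 \<le> n" for n
    proof -
      have "R \<le> real (Suc n0)" unfolding n0_def by linarith
      then have "L / real (Suc n0) powr e < \<epsilon> / 2" by (rule R)
      moreover have "norm (m (real (Suc n0)) - m (real (Suc n))) \<le> L / real (Suc n0) powr e"
        using that by (intro L(2)) auto
      ultimately show ?thesis unfolding dist_norm by linarith
    qed
    have "dist (m (real (Suc i))) (m (real (Suc j))) < \<epsilon>" if "n0 \<le> i" "n0 \<le> j" for i j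
      by (rule dist_triangle_half_r[OF near[OF that(1)] near[OF that(2)]])
    then show "\<exists>M. \<forall>i\<ge>M. \<forall>j\<ge>M. dist (m (real (Suc i))) (m (real (Suc j))) < \<epsilon>" by blast
  qed
  then obtain c where c: "(\<lambda>n. m (real (Suc n))) \<longlonglongrightarrow> c"
    by (auto simp: Cauchy_convergent_iff convergent_def)
  have mc: "norm (m r - c) \<le> L / r powr e" if r: "0 < r" for r
  proof (rule tendsto_upperbound)
    show "(\<lambda>n. norm (m r - m (real (Suc n)))) \<longlonglongrightarrow> norm (m r - c)"
      by (intro tendsto_intros c)
    obtain k :: nat where k: "r \<le> real k" using real_arch_simple by blast
    show "eventually (\<lambda>n. norm (m r - m (real (Suc n))) \<le> L / r powr e) sequentially"
      using eventually_ge_at_top[of k]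
    proof eventually_elim
      case (elim n)
      then show ?case using k by (intro L(2) r) simp
    qed
  qed simp
  \<comment> \<open>Chosen so that M^p = 2^p (N^p + L^p), the constant produced by splitting f - c
    at m(r).\<close>
  define M where "M = 2 * (N powr p + L powr p) powr (1 / p)"
  have M: "M powr p = 2 powr p * (N powr p + L powr p)"
    using p by (simp add: M_def powr_mult powr_powr)
  show ?thesis
  proof
    show "0 \<le> M" by (simp add: M_def)
    fix r :: real assume r: "0 < r"
    have V: "dunkl_vol \<alpha> r > 0" by (rule emeasure_dunkl_borel_ball(2)[OF \<alpha> r])
    have "(\<integral>\<^sup>+y\<in>ball 0 r. ennreal (norm (f y - c) powr p) \<partial>dunkl_borel \<alpha>) =
      (\<integral>\<^sup>+y\<in>ball 0 r. ennreal (norm ((f y - m r) + (m r - c)) powr p) \<partial>dunkl_borel \<alpha>)" by simp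
    also have "\<dots> \<le> ennreal (2 powr p) * ((\<integral>\<^sup>+y\<in>ball 0 r. ennreal (norm (f y - m r) powr p) \<partial>dunkl_borel \<alpha>) +
      (\<integral>\<^sup>+y\<in>ball 0 r. ennreal (norm (m r - c) powr p) \<partial>dunkl_borel \<alpha>))"
      by (rule nn_integral_norm_add_powr_le) (use p in auto)
    also have "\<dots> \<le> ennreal (2 powr p) * (ennreal (dunkl_vol \<alpha> r * (N / r powr e) powr p) +
      ennreal (dunkl_vol \<alpha> r * (L / r powr e) powr p))"
      using mc[OF r] p V
      by (intro mult_left_mono add_mono bound r)
         (auto simp: nn_integral_ball_const[OF \<alpha>] intro!: ennreal_leI powr_mono2 mult_left_mono)
    also have "\<dots> = ennreal (2 powr p * (dunkl_vol \<alpha> r * (N / r powr e) powr p +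
       dunkl_vol \<alpha> r * (L / r powr e) powr p))"
      using V by (simp add: ennreal_mult')
    also have "2 powr p * (dunkl_vol \<alpha> r * (N / r powr e) powr p +
       dunkl_vol \<alpha> r * (L / r powr e) powr p) = dunkl_vol \<alpha> r * (M / r powr e) powr p"
      unfolding powr_divide M by (simp add: add_divide_distrib distrib_left mult_ac)
    finally show "(\<integral>\<^sup>+y\<in>ball 0 r. ennreal (norm (f y - c) powr p) \<partial>dunkl_borel \<alpha>)
      \<le> ennreal (dunkl_vol \<alpha> r * (M / r powr e) powr p)" .
  qed
qed

text \<open>The elementary inequality a \<le> s + s^(1-p) a^p with s = r^(-e) keeps the decay
  r^(-e), which matches the weight in K_\<psi> under dilation. The constant 1 + M^p is not
  homogeneous in g, but it serves only to show finiteness.\<close>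

lemma morrey_L1:
  fixes g :: "real \<Rightarrow> complex"
  assumes \<alpha>: "\<alpha> \<ge> - 1 / 2" and g [measurable]: "g \<in> borel_measurable borel"
    and p: "1 \<le> p" and M: "0 \<le> M" and r: "0 < r"
    and bound: "(\<integral>\<^sup>+y\<in>ball 0 r. ennreal (norm (g y) powr p) \<partial>dunkl_borel \<alpha>)
      \<le> ennreal (dunkl_vol \<alpha> r * (M / r powr e) powr p)"
  shows "(\<integral>\<^sup>+y\<in>ball 0 r. ennreal (norm (g y)) \<partial>dunkl_borel \<alpha>)
      \<le> ennreal (dunkl_vol \<alpha> r * ((1 + M powr p) / r powr e))"
proof -
  define s where "s = 1 / r powr e"
  have s: "s > 0" using r by (simp add: s_def)
  have V: "dunkl_vol \<alpha> r > 0" by (rule emeasure_dunkl_borel_ball(2)[OF \<alpha> r])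
  \<comment> \<open>If a > s, then (a/s)^(p-1) \<ge> 1.\<close>
  have young: "a \<le> s + s powr (1 - p) * a powr p" if "0 \<le> a" for a
  proof (cases "a \<le> s")
    case True
    then show ?thesis by (simp add: add_increasing2)
  next
    case False
    have "s powr (p - 1) \<le> a powr (p - 1)" using False s p by (intro powr_mono2) auto
    then have "s powr (1 - p) * s powr (p - 1) * a \<le> s powr (1 - p) * a powr (p - 1) * a"
      using that by (intro mult_right_mono mult_left_mono) auto
    moreover have "s powr (1 - p) * s powr (p - 1) = 1" using s by (simp flip: powr_add)
    moreover have "a powr (p - 1) * a = a powr p" using False s by (simp add: powr_diff)
    ultimately show ?thesis using s by (simp add: mult.assoc)
  qed
  have "(\<integral>\<^sup>+y\<in>ball 0 r. ennreal (norm (g y)) \<partial>dunkl_borel \<alpha>) \<le>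
    (\<integral>\<^sup>+y. ennreal s * indicator (ball 0 r) y + ennreal (s powr (1 - p)) *
      (ennreal (norm (g y) powr p) * indicator (ball 0 r) y) \<partial>dunkl_borel \<alpha>)"
  proof (rule nn_integral_mono)
    fix y
    have "ennreal (norm (g y)) \<le> ennreal (s + s powr (1 - p) * norm (g y) powr p)"
      by (intro ennreal_leI young) simp
    also have "\<dots> = ennreal s + ennreal (s powr (1 - p)) * ennreal (norm (g y) powr p)"
      using s by (simp add: ennreal_mult')
    finally show "ennreal (norm (g y)) * indicator (ball 0 r) y \<le>
      ennreal s * indicator (ball 0 r) y + ennreal (s powr (1 - p)) *
      (ennreal (norm (g y) powr p) * indicator (ball 0 r) y)"
      by (simp add: indicator_def)
  qed
  also have "\<dots> = ennreal (dunkl_vol \<alpha> r * s) + ennreal (s powr (1 - p)) *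
      (\<integral>\<^sup>+y\<in>ball 0 r. ennreal (norm (g y) powr p) \<partial>dunkl_borel \<alpha>)"
    using s by (subst nn_integral_add) (auto simp: nn_integral_cmult nn_integral_ball_const[OF \<alpha>, symmetric])
  also have "\<dots> \<le> ennreal (dunkl_vol \<alpha> r * s) + ennreal (s powr (1 - p)) *
      ennreal (dunkl_vol \<alpha> r * (M / r powr e) powr p)"
    by (intro add_left_mono mult_left_mono bound) simp
  also have "\<dots> = ennreal (dunkl_vol \<alpha> r * s + s powr (1 - p) * (dunkl_vol \<alpha> r * (M / r powr e) powr p))"
    using V s by (simp add: ennreal_mult')
  also have "dunkl_vol \<alpha> r * s + s powr (1 - p) * (dunkl_vol \<alpha> r * (M / r powr e) powr p) =
      dunkl_vol \<alpha> r * ((1 + M powr p) / r powr e)"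
  proof -
    have "(M / r powr e) powr p = M powr p * s powr p"
      by (simp add: s_def powr_divide)
    moreover have "s powr (1 - p) * s powr p = s" using s by (simp flip: powr_add)
    ultimately have "s powr (1 - p) * (dunkl_vol \<alpha> r * (M / r powr e) powr p) = dunkl_vol \<alpha> r * (M powr p * s)"
      by (metis mult.assoc mult.commute)
    then show ?thesis by (simp add: s_def algebra_simps add_divide_distrib)
  qed
  finally show ?thesis .
qed

section \<open>The Hausdorff operator\<close>

text \<open>\<open>e\<close> stands for d_\<alpha>/q, so that d_\<alpha> - e = d_\<alpha>(1 - 1/q)
  and \<open>K\<close> is K_\<psi>; \<open>\<psi>\<close> will be a Borel representative of the
  given function.\<close>

locale dunkl_hausdorff =
  fixes \<alpha> p e K :: real and \<psi> :: "real \<Rightarrow> complex"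
  assumes alpha: "\<alpha> \<ge> - 1 / 2" and p: "1 \<le> p" and e: "0 < e"
    and psi [measurable]: "\<psi> \<in> borel_measurable borel"
    and K0: "0 \<le> K"
    and K: "(\<integral>\<^sup>+t. ennreal (norm (\<psi> t) / \<bar>t\<bar> powr (dunkl_dim \<alpha> - e)) \<partial>lborel) = ennreal K"
begin

definition \<phi> :: "real \<Rightarrow> complex" where
  "\<phi> t = \<psi> t /\<^sub>R \<bar>t\<bar> powr dunkl_dim \<alpha>"

text \<open>Equal to |\<phi>(t)| |t|^e, where |t|^e is the cost of a dilation by t; this is the
  weight of mass \<open>K\<close> to which Jensen's inequality is applied.\<close>

definition k :: "real \<Rightarrow> real" where
  "k t = norm (\<psi> t) / \<bar>t\<bar> powr (dunkl_dim \<alpha> - e)"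

definition H :: "(real \<Rightarrow> complex) \<Rightarrow> real \<Rightarrow> complex" where
  "H f x = (LINT t|lborel. \<phi> t * f (x / t))"

lemma measurable_phi [measurable]: "\<phi> \<in> borel_measurable borel"
  unfolding \<phi>_def by measurable

lemma measurable_k [measurable]: "k \<in> borel_measurable borel"
  unfolding k_def by measurable

lemma k_nonneg: "0 \<le> k t"
  by (simp add: k_def)

lemma nn_integral_k: "(\<integral>\<^sup>+t. ennreal (k t) \<partial>lborel) = ennreal K"
  using K by (simp add: k_def)

lemma norm_phi: "norm (\<phi> t) = k t * \<bar>t\<bar> powr (- e)"
  by (cases "t = 0") (simp_all add: \<phi>_def k_def powr_diff powr_minus divide_inverse)

sublocale mu: sigma_finite_measure "dunkl_borel \<alpha>"
  by (rule sigma_finite_dunkl_borel)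

sublocale lm: pair_sigma_finite lborel "dunkl_borel \<alpha>" ..

sublocale mm: pair_sigma_finite "dunkl_borel \<alpha>" "dunkl_borel \<alpha>" ..

lemma measurable_H [measurable]:
  assumes [measurable]: "f \<in> borel_measurable borel"
  shows "H f \<in> borel_measurable borel"
  unfolding H_def by measurable

lemma phi_zero: "\<phi> 0 = 0"
  by (simp add: \<phi>_def)

section \<open>Minkowski and Tonelli estimates for the kernel\<close>

text \<open>Minkowski's integral inequality for slices of p-norm at most P^(1/p) |t|^e. Jensen's
  inequality with weight \<open>k\<close> is applied to |t|^(-e) |G(t,y)|; these normalised slices
  share the bound P, so nothing is lost: K^(p-1) from Jensen and K from the remaining integral give
  K^p.\<close>

lemma minkowski:
  fixes G :: "real \<Rightarrow> real \<Rightarrow> complex"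
  assumes [measurable]: "case_prod G \<in> borel_measurable (borel \<Otimes>\<^sub>M borel)"
    and P: "0 \<le> P"
    and bound: "\<And>t. t \<noteq> 0 \<Longrightarrow> (\<integral>\<^sup>+y\<in>ball 0 R. ennreal (norm (G t y) powr p) \<partial>dunkl_borel \<alpha>)
      \<le> ennreal (P * \<bar>t\<bar> powr (e * p))"
  shows "(\<integral>\<^sup>+y\<in>ball 0 R. ennreal (norm (LINT t|lborel. \<phi> t * G t y) powr p) \<partial>dunkl_borel \<alpha>)
    \<le> ennreal (K powr p * P)"
proof -
  have [measurable]: "case_prod G \<in> borel_measurable (lborel \<Otimes>\<^sub>M dunkl_borel \<alpha>)"
    "case_prod G \<in> borel_measurable (dunkl_borel \<alpha> \<Otimes>\<^sub>M lborel)"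
    using assms(1) by (simp_all cong: measurable_cong_sets sets_pair_measure_cong)
  define h where "h t y = k t * (\<bar>t\<bar> powr (- e) * norm (G t y)) powr p" for t y
  have h: "h t y = k t * \<bar>t\<bar> powr (- e * p) * norm (G t y) powr p" for t y
    by (simp add: h_def powr_mult powr_powr)
  have [measurable]: "(\<lambda>(t, y). h t y) \<in> borel_measurable (lborel \<Otimes>\<^sub>M dunkl_borel \<alpha>)"
    unfolding h_def by measurable
  have "(\<integral>\<^sup>+y\<in>ball 0 R. ennreal (norm (LINT t|lborel. \<phi> t * G t y) powr p) \<partial>dunkl_borel \<alpha>) \<le>
    (\<integral>\<^sup>+y. ennreal (K powr (p - 1)) * (\<integral>\<^sup>+t. ennreal (h t y) * indicator (ball 0 R) y \<partial>lborel) \<partial>dunkl_borel \<alpha>)"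
  proof (rule nn_integral_mono)
    fix y
    have [measurable]: "(\<lambda>t. G t y) \<in> borel_measurable borel" by measurable
    have "ennreal (norm (LINT t|lborel. \<phi> t * G t y) powr p) \<le>
      ennreal (K powr (p - 1)) * (\<integral>\<^sup>+t. ennreal (h t y) \<partial>lborel)"
      unfolding h_def
      by (rule norm_integral_powr_le)
         (auto simp: k_nonneg nn_integral_k K0 p norm_mult norm_phi mult.assoc)
    then show "ennreal (norm (LINT t|lborel. \<phi> t * G t y) powr p) * indicator (ball 0 R) y \<le>
      ennreal (K powr (p - 1)) * (\<integral>\<^sup>+t. ennreal (h t y) * indicator (ball 0 R) y \<partial>lborel)"
      by (simp add: indicator_def)
  qed
  also have "\<dots> = ennreal (K powr (p - 1)) *
      (\<integral>\<^sup>+y. \<integral>\<^sup>+t. ennreal (h t y) * indicator (ball 0 R) y \<partial>lborel \<partial>dunkl_borel \<alpha>)"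
    by (rule nn_integral_cmult) measurable
  also have "(\<integral>\<^sup>+y. \<integral>\<^sup>+t. ennreal (h t y) * indicator (ball 0 R) y \<partial>lborel \<partial>dunkl_borel \<alpha>) =
      (\<integral>\<^sup>+t. \<integral>\<^sup>+y. ennreal (h t y) * indicator (ball 0 R) y \<partial>dunkl_borel \<alpha> \<partial>lborel)"
    by (rule lm.Fubini') measurable
  also have "\<dots> \<le> (\<integral>\<^sup>+t. ennreal P * ennreal (k t) \<partial>lborel)"
  proof (rule nn_integral_mono)
    fix t :: real
    have [measurable]: "G t \<in> borel_measurable borel" by measurable
    show "(\<integral>\<^sup>+y. ennreal (h t y) * indicator (ball 0 R) y \<partial>dunkl_borel \<alpha>) \<le> ennreal P * ennreal (k t)"
    proof (cases "t = 0")
      \<comment> \<open>At t = 0 the weight vanishes by the convention for division by 0.\<close>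
      case True
      then show ?thesis by (simp add: h_def k_def)
    next
      case False
      have "(\<integral>\<^sup>+y. ennreal (h t y) * indicator (ball 0 R) y \<partial>dunkl_borel \<alpha>) =
        (\<integral>\<^sup>+y. ennreal (k t * \<bar>t\<bar> powr (- e * p)) * (ennreal (norm (G t y) powr p) * indicator (ball 0 R) y)
          \<partial>dunkl_borel \<alpha>)"
        unfolding h by (simp add: ennreal_mult' k_nonneg mult.assoc)
      also have "\<dots> = ennreal (k t * \<bar>t\<bar> powr (- e * p)) *
          (\<integral>\<^sup>+y\<in>ball 0 R. ennreal (norm (G t y) powr p) \<partial>dunkl_borel \<alpha>)"
        by (rule nn_integral_cmult) measurable
      also have "\<dots> \<le> ennreal (k t * \<bar>t\<bar> powr (- e * p)) * ennreal (P * \<bar>t\<bar> powr (e * p))"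
        by (intro mult_left_mono bound False) simp
      also have "\<dots> = ennreal (k t * \<bar>t\<bar> powr (- e * p) * (P * \<bar>t\<bar> powr (e * p)))"
        by (rule ennreal_mult'[symmetric]) (simp add: k_nonneg)
      also have "k t * \<bar>t\<bar> powr (- e * p) * (P * \<bar>t\<bar> powr (e * p)) = P * k t"
        using False by (simp add: powr_minus)
      also have "ennreal (P * k t) = ennreal P * ennreal (k t)"
        by (rule ennreal_mult'[OF P])
      finally show ?thesis .
    qed
  qed
  also have "\<dots> = ennreal P * ennreal K"
    by (subst nn_integral_cmult) (auto simp: nn_integral_k)
  also have "ennreal (K powr (p - 1)) * (ennreal P * ennreal K) = ennreal (K powr (p - 1) * (P * K))"
    using P K0 by (simp add: ennreal_mult)
  also have "K powr (p - 1) * (P * K) = K powr p * P"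
    using K0 by (cases "K = 0") (auto simp: powr_diff)
  finally show ?thesis by (simp add: mult_left_mono)
qed

text \<open>The same computation for p = 1 with the modulus inside the t-integral. It yields
  absolute convergence for almost every y, which \<open>minkowski\<close> does not give, since a
  divergent integral counts as 0 there.\<close>

lemma tonelli_bound:
  fixes G :: "real \<Rightarrow> real \<Rightarrow> complex"
  assumes [measurable]: "case_prod G \<in> borel_measurable (borel \<Otimes>\<^sub>M borel)"
    and P: "0 \<le> P"
    and bound: "\<And>t. t \<noteq> 0 \<Longrightarrow> (\<integral>\<^sup>+y\<in>ball 0 R. ennreal (norm (G t y)) \<partial>dunkl_borel \<alpha>)
      \<le> ennreal (P * \<bar>t\<bar> powr e)"
  shows "(\<integral>\<^sup>+y\<in>ball 0 R. (\<integral>\<^sup>+t. ennreal (norm (\<phi> t * G t y)) \<partial>lborel) \<partial>dunkl_borel \<alpha>)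
    \<le> ennreal (P * K)"
proof -
  have [measurable]: "case_prod G \<in> borel_measurable (lborel \<Otimes>\<^sub>M dunkl_borel \<alpha>)"
    "case_prod G \<in> borel_measurable (dunkl_borel \<alpha> \<Otimes>\<^sub>M lborel)"
    using assms(1) by (simp_all cong: measurable_cong_sets sets_pair_measure_cong)
  have "(\<integral>\<^sup>+y\<in>ball 0 R. (\<integral>\<^sup>+t. ennreal (norm (\<phi> t * G t y)) \<partial>lborel) \<partial>dunkl_borel \<alpha>) =
      (\<integral>\<^sup>+y. \<integral>\<^sup>+t. ennreal (norm (\<phi> t * G t y)) * indicator (ball 0 R) y \<partial>lborel \<partial>dunkl_borel \<alpha>)"
    by (intro nn_integral_cong nn_integral_multc[symmetric]) measurable
  also have "\<dots> = (\<integral>\<^sup>+t. \<integral>\<^sup>+y. ennreal (norm (\<phi> t * G t y)) * indicator (ball 0 R) y \<partial>dunkl_borel \<alpha> \<partial>lborel)"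
    by (rule lm.Fubini') measurable
  also have "\<dots> \<le> (\<integral>\<^sup>+t. ennreal P * ennreal (k t) \<partial>lborel)"
  proof (rule nn_integral_mono)
    fix t :: real
    have [measurable]: "G t \<in> borel_measurable borel" by measurable
    show "(\<integral>\<^sup>+y. ennreal (norm (\<phi> t * G t y)) * indicator (ball 0 R) y \<partial>dunkl_borel \<alpha>) \<le> ennreal P * ennreal (k t)"
    proof (cases "t = 0")
      case True
      then show ?thesis by (simp add: phi_zero)
    next
      case False
      have "(\<integral>\<^sup>+y. ennreal (norm (\<phi> t * G t y)) * indicator (ball 0 R) y \<partial>dunkl_borel \<alpha>) =
        (\<integral>\<^sup>+y. ennreal (norm (\<phi> t)) * (ennreal (norm (G t y)) * indicator (ball 0 R) y) \<partial>dunkl_borel \<alpha>)"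
        by (simp add: norm_mult ennreal_mult' mult.assoc)
      also have "\<dots> = ennreal (norm (\<phi> t)) * (\<integral>\<^sup>+y\<in>ball 0 R. ennreal (norm (G t y)) \<partial>dunkl_borel \<alpha>)"
        by (rule nn_integral_cmult) measurable
      also have "\<dots> \<le> ennreal (norm (\<phi> t)) * ennreal (P * \<bar>t\<bar> powr e)"
        by (intro mult_left_mono bound False) simp
      also have "\<dots> = ennreal (norm (\<phi> t) * (P * \<bar>t\<bar> powr e))"
        by (rule ennreal_mult'[symmetric]) simp
      also have "norm (\<phi> t) * (P * \<bar>t\<bar> powr e) = P * k t"
        using False by (simp add: norm_phi powr_minus)
      also have "ennreal (P * k t) = ennreal P * ennreal (k t)"
        by (rule ennreal_mult'[OF P])
      finally show ?thesis .
    qed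
  qed
  also have "\<dots> = ennreal P * ennreal K"
    by (subst nn_integral_cmult) (auto simp: nn_integral_k)
  also have "\<dots> = ennreal (P * K)" using P by (rule ennreal_mult'[symmetric])
  finally show ?thesis .
qed

section \<open>Dilated Morrey functions and almost everywhere convergence\<close>

text \<open>The Jacobian |t|^d_\<alpha> cancels the volume ratio of the two balls, and the radius
  R/|t| in place of R leaves |t|^e.\<close>

lemma vol_scale:
  assumes "t \<noteq> 0" "0 < R"
  shows "\<bar>t\<bar> powr dunkl_dim \<alpha> * (dunkl_vol \<alpha> (R / \<bar>t\<bar>) * (M / (R / \<bar>t\<bar>) powr e)) =
    dunkl_vol \<alpha> R * (M / R powr e) * \<bar>t\<bar> powr e"
  and "\<bar>t\<bar> powr dunkl_dim \<alpha> * (dunkl_vol \<alpha> (R / \<bar>t\<bar>) * (M / (R / \<bar>t\<bar>) powr e) powr p) =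
    dunkl_vol \<alpha> R * (M / R powr e) powr p * \<bar>t\<bar> powr (e * p)"
  using assms emeasure_dunkl_borel_ball(3)[OF alpha assms(1), of R]
  by (simp_all add: powr_divide powr_mult powr_powr)

lemma ball_scaled_bound:
  fixes g :: "real \<Rightarrow> complex"
  assumes [measurable]: "g \<in> borel_measurable borel" and t: "t \<noteq> 0" and R: "0 < R"
    and bound: "(\<integral>\<^sup>+y\<in>ball 0 (R / \<bar>t\<bar>). ennreal (norm (g y) powr p) \<partial>dunkl_borel \<alpha>)
      \<le> ennreal (dunkl_vol \<alpha> (R / \<bar>t\<bar>) * (M / (R / \<bar>t\<bar>) powr e) powr p)"
  shows "(\<integral>\<^sup>+y\<in>ball 0 R. ennreal (norm (g (y / t)) powr p) \<partial>dunkl_borel \<alpha>)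
      \<le> ennreal (dunkl_vol \<alpha> R * (M / R powr e) powr p * \<bar>t\<bar> powr (e * p))"
proof -
  have "(\<integral>\<^sup>+y\<in>ball 0 R. ennreal (norm (g (y / t)) powr p) \<partial>dunkl_borel \<alpha>) =
    ennreal (\<bar>t\<bar> powr dunkl_dim \<alpha>) * (\<integral>\<^sup>+y\<in>ball 0 (R / \<bar>t\<bar>). ennreal (norm (g y) powr p) \<partial>dunkl_borel \<alpha>)"
    by (rule nn_integral_dunkl_ball_scale[OF _ t]) measurable
  also have "\<dots> \<le> ennreal (\<bar>t\<bar> powr dunkl_dim \<alpha>) *
      ennreal (dunkl_vol \<alpha> (R / \<bar>t\<bar>) * (M / (R / \<bar>t\<bar>) powr e) powr p)"
    by (intro mult_left_mono bound) simp
  also have "\<dots> = ennreal (\<bar>t\<bar> powr dunkl_dim \<alpha> * (dunkl_vol \<alpha> (R / \<bar>t\<bar>) * (M / (R / \<bar>t\<bar>) powr e) powr p))"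
    by (rule ennreal_mult'[symmetric]) simp
  finally show ?thesis unfolding vol_scale(2)[OF t R] .
qed

lemma ball_scaled_bound_L1:
  fixes g :: "real \<Rightarrow> complex"
  assumes [measurable]: "g \<in> borel_measurable borel" and t: "t \<noteq> 0" and R: "0 < R"
    and bound: "(\<integral>\<^sup>+y\<in>ball 0 (R / \<bar>t\<bar>). ennreal (norm (g y)) \<partial>dunkl_borel \<alpha>)
      \<le> ennreal (dunkl_vol \<alpha> (R / \<bar>t\<bar>) * (M / (R / \<bar>t\<bar>) powr e))"
  shows "(\<integral>\<^sup>+y\<in>ball 0 R. ennreal (norm (g (y / t))) \<partial>dunkl_borel \<alpha>)
      \<le> ennreal (dunkl_vol \<alpha> R * (M / R powr e) * \<bar>t\<bar> powr e)"
proof -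
  have "(\<integral>\<^sup>+y\<in>ball 0 R. ennreal (norm (g (y / t))) \<partial>dunkl_borel \<alpha>) =
    ennreal (\<bar>t\<bar> powr dunkl_dim \<alpha>) * (\<integral>\<^sup>+y\<in>ball 0 (R / \<bar>t\<bar>). ennreal (norm (g y)) \<partial>dunkl_borel \<alpha>)"
    by (rule nn_integral_dunkl_ball_scale[OF _ t]) measurable
  also have "\<dots> \<le> ennreal (\<bar>t\<bar> powr dunkl_dim \<alpha>) *
      ennreal (dunkl_vol \<alpha> (R / \<bar>t\<bar>) * (M / (R / \<bar>t\<bar>) powr e))"
    by (intro mult_left_mono bound) simp
  also have "\<dots> = ennreal (\<bar>t\<bar> powr dunkl_dim \<alpha> * (dunkl_vol \<alpha> (R / \<bar>t\<bar>) * (M / (R / \<bar>t\<bar>) powr e)))"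
    by (rule ennreal_mult'[symmetric]) simp
  finally show ?thesis unfolding vol_scale(1)[OF t R] .
qed

lemma AE_all_balls:
  assumes "\<And>R. 0 < R \<Longrightarrow> AE y in dunkl_borel \<alpha>. y \<in> ball 0 R \<longrightarrow> P y"
  shows "AE y in dunkl_borel \<alpha>. P y"
proof -
  have "AE y in dunkl_borel \<alpha>. \<forall>n::nat. y \<in> ball 0 (real (Suc n)) \<longrightarrow> P y"
    unfolding AE_all_countable by (intro allI assms) simp
  then show ?thesis
  proof eventually_elim
    case (elim y)
    obtain n :: nat where "\<bar>y\<bar> < real n" using reals_Archimedean2 by blast
    then have "y \<in> ball 0 (real (Suc n))" by simp
    then show ?case using elim by blast
  qed
qed

lemma AE_ball_finite:
  assumes [measurable]: "h \<in> borel_measurable borel"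
    and "\<And>R. 0 < R \<Longrightarrow> (\<integral>\<^sup>+y\<in>ball 0 R. h y \<partial>dunkl_borel \<alpha>) < \<infinity>"
  shows "AE y in dunkl_borel \<alpha>. h y < \<infinity>"
proof (rule AE_all_balls)
  fix R :: real assume "0 < R"
  then have "(\<integral>\<^sup>+y\<in>ball 0 R. h y \<partial>dunkl_borel \<alpha>) \<noteq> \<infinity>" using assms(2)[of R] by auto
  then have "AE y in dunkl_borel \<alpha>. h y * indicator (ball 0 R) y \<noteq> \<infinity>"
    by (intro nn_integral_PInf_AE) auto
  then show "AE y in dunkl_borel \<alpha>. y \<in> ball 0 R \<longrightarrow> h y < \<infinity>"
    by eventually_elim (auto simp: less_top)
qed

text \<open>Applied to f - c, this gives local p-integrability of the image; absolute convergence is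
  the separate statement \<open>H_morrey_finite\<close>.\<close>

lemma H_morrey_Lp:
  assumes [measurable]: "g \<in> borel_measurable borel" and R: "0 < R"
    and bound: "\<And>r. 0 < r \<Longrightarrow> (\<integral>\<^sup>+y\<in>ball 0 r. ennreal (norm (g y) powr p) \<partial>dunkl_borel \<alpha>)
      \<le> ennreal (dunkl_vol \<alpha> r * (M / r powr e) powr p)"
  shows "(\<integral>\<^sup>+y\<in>ball 0 R. ennreal (norm (H g y) powr p) \<partial>dunkl_borel \<alpha>)
      \<le> ennreal (K powr p * (dunkl_vol \<alpha> R * (M / R powr e) powr p))"
  unfolding H_def
proof (rule minkowski)
  show "(\<lambda>(t, y). g (y / t)) \<in> borel_measurable (borel \<Otimes>\<^sub>M borel)" by measurable
  show "0 \<le> dunkl_vol \<alpha> R * (M / R powr e) powr p"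
    using emeasure_dunkl_borel_ball(2)[OF alpha R] by simp
  show "(\<integral>\<^sup>+y\<in>ball 0 R. ennreal (norm (g (y / t)) powr p) \<partial>dunkl_borel \<alpha>)
      \<le> ennreal (dunkl_vol \<alpha> R * (M / R powr e) powr p * \<bar>t\<bar> powr (e * p))" if "t \<noteq> 0" for t
    using that R by (intro ball_scaled_bound bound) auto
qed

lemma H_morrey_finite:
  assumes [measurable]: "g \<in> borel_measurable borel" and R: "0 < R" and M: "0 \<le> M"
    and bound: "\<And>r. 0 < r \<Longrightarrow> (\<integral>\<^sup>+y\<in>ball 0 r. ennreal (norm (g y) powr p) \<partial>dunkl_borel \<alpha>)
      \<le> ennreal (dunkl_vol \<alpha> r * (M / r powr e) powr p)"
  shows "(\<integral>\<^sup>+y\<in>ball 0 R. (\<integral>\<^sup>+t. ennreal (norm (\<phi> t * g (y / t))) \<partial>lborel) \<partial>dunkl_borel \<alpha>) < \<infinity>"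
proof -
  have "(\<integral>\<^sup>+y\<in>ball 0 R. (\<integral>\<^sup>+t. ennreal (norm (\<phi> t * g (y / t))) \<partial>lborel) \<partial>dunkl_borel \<alpha>)
    \<le> ennreal (dunkl_vol \<alpha> R * ((1 + M powr p) / R powr e) * K)"
  proof (rule tonelli_bound)
    show "(\<lambda>(t, y). g (y / t)) \<in> borel_measurable (borel \<Otimes>\<^sub>M borel)" by measurable
    show "0 \<le> dunkl_vol \<alpha> R * ((1 + M powr p) / R powr e)"
      using emeasure_dunkl_borel_ball(2)[OF alpha R] by simp
    show "(\<integral>\<^sup>+y\<in>ball 0 R. ennreal (norm (g (y / t))) \<partial>dunkl_borel \<alpha>)
        \<le> ennreal (dunkl_vol \<alpha> R * ((1 + M powr p) / R powr e) * \<bar>t\<bar> powr e)" if "t \<noteq> 0" for t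
      using that R by (intro ball_scaled_bound_L1 morrey_L1[OF alpha _ p M] bound) auto
  qed
  also have "\<dots> < \<infinity>" by simp
  finally show ?thesis .
qed

lemma AE_integrable_kernel:
  assumes [measurable]: "g \<in> borel_measurable borel"
    and fin: "\<And>R. 0 < R \<Longrightarrow>
      (\<integral>\<^sup>+y\<in>ball 0 R. (\<integral>\<^sup>+t. ennreal (norm (\<phi> t * g (y / t))) \<partial>lborel) \<partial>dunkl_borel \<alpha>) < \<infinity>"
  shows "AE y in dunkl_borel \<alpha>. integrable lborel (\<lambda>t. \<phi> t * g (y / t))"
proof -
  have "AE y in dunkl_borel \<alpha>. (\<integral>\<^sup>+t. ennreal (norm (\<phi> t * g (y / t))) \<partial>lborel) < \<infinity>"
    by (rule AE_ball_finite[OF _ fin]) measurable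
  then show ?thesis by eventually_elim (simp add: integrable_iff_bounded)
qed

section \<open>Returning from f - c to f\<close>

text \<open>The condition on c says exactly that \<open>\<phi> t * c\<close> is integrable; its
  contribution is then a finite constant times the finite volume of the ball.\<close>

lemma kernel_finite_add_const:
  assumes f [measurable]: "f \<in> borel_measurable borel" and R: "0 < R"
    and c: "c = 0 \<or> integrable lborel \<phi>"
    and fin: "(\<integral>\<^sup>+y\<in>ball 0 R. (\<integral>\<^sup>+t. ennreal (norm (\<phi> t * (f (y / t) - c))) \<partial>lborel) \<partial>dunkl_borel \<alpha>) < \<infinity>"
  shows "(\<integral>\<^sup>+y\<in>ball 0 R. (\<integral>\<^sup>+t. ennreal (norm (\<phi> t * f (y / t))) \<partial>lborel) \<partial>dunkl_borel \<alpha>) < \<infinity>"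
proof -
  define I where "I = (\<integral>\<^sup>+t. ennreal (norm (\<phi> t * c)) \<partial>lborel)"
  have "integrable lborel (\<lambda>t. \<phi> t * c)" using c by auto
  then have I: "I < \<infinity>" by (simp add: integrable_iff_bounded I_def)
  have "(\<integral>\<^sup>+y\<in>ball 0 R. (\<integral>\<^sup>+t. ennreal (norm (\<phi> t * f (y / t))) \<partial>lborel) \<partial>dunkl_borel \<alpha>) \<le>
    (\<integral>\<^sup>+y. (\<integral>\<^sup>+t. ennreal (norm (\<phi> t * (f (y / t) - c))) \<partial>lborel) * indicator (ball 0 R) y +
       I * indicator (ball 0 R) y \<partial>dunkl_borel \<alpha>)"
  proof (rule nn_integral_mono)
    fix y
    have "(\<integral>\<^sup>+t. ennreal (norm (\<phi> t * f (y / t))) \<partial>lborel) \<le>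
      (\<integral>\<^sup>+t. ennreal (norm (\<phi> t * (f (y / t) - c))) + ennreal (norm (\<phi> t * c)) \<partial>lborel)"
    proof (rule nn_integral_mono)
      fix t
      have "norm (\<phi> t * f (y / t)) \<le> norm (\<phi> t * (f (y / t) - c)) + norm (\<phi> t * c)"
        using norm_triangle_ineq[of "\<phi> t * (f (y / t) - c)" "\<phi> t * c"] by (simp add: algebra_simps)
      from ennreal_leI[OF this]
      show "ennreal (norm (\<phi> t * f (y / t))) \<le>
          ennreal (norm (\<phi> t * (f (y / t) - c))) + ennreal (norm (\<phi> t * c))"
        by (simp only: ennreal_plus norm_ge_zero)
    qed
    also have "\<dots> = (\<integral>\<^sup>+t. ennreal (norm (\<phi> t * (f (y / t) - c))) \<partial>lborel) + I"
      unfolding I_def by (rule nn_integral_add) measurable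
    finally show "(\<integral>\<^sup>+t. ennreal (norm (\<phi> t * f (y / t))) \<partial>lborel) * indicator (ball 0 R) y \<le>
      (\<integral>\<^sup>+t. ennreal (norm (\<phi> t * (f (y / t) - c))) \<partial>lborel) * indicator (ball 0 R) y +
       I * indicator (ball 0 R) y"
      by (simp add: indicator_def)
  qed
  also have "\<dots> = (\<integral>\<^sup>+y\<in>ball 0 R. (\<integral>\<^sup>+t. ennreal (norm (\<phi> t * (f (y / t) - c))) \<partial>lborel) \<partial>dunkl_borel \<alpha>) +
      I * emeasure (dunkl_borel \<alpha>) (ball 0 R)"
    by (subst nn_integral_add) (auto simp: nn_integral_cmult_indicator)
  also have "\<dots> < \<infinity>"
    using fin I by (simp add: emeasure_dunkl_borel_ball(1)[OF alpha] ennreal_mult_less_top)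
  finally show ?thesis .
qed

lemma AE_H_split:
  assumes [measurable]: "f \<in> borel_measurable borel"
    and c: "c = 0 \<or> integrable lborel \<phi>"
    and int: "AE y in dunkl_borel \<alpha>. integrable lborel (\<lambda>t. \<phi> t * (f (y / t) - c))"
  shows "AE y in dunkl_borel \<alpha>. H f y = H (\<lambda>z. f z - c) y + (LINT t|lborel. \<phi> t * c)"
  using int
proof eventually_elim
  case (elim y)
  have "integrable lborel (\<lambda>t. \<phi> t * c)" using c by auto
  from Bochner_Integration.integral_add[OF elim this] show ?case
    by (simp add: H_def algebra_simps)
qed

text \<open>If the integral for f converged at such a y, subtracting the convergent one for f - c
  would make \<open>\<phi> t * c\<close> integrable, hence \<phi>.\<close>

lemma AE_H_zero:
  assumes [measurable]: "f \<in> borel_measurable borel"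
    and c: "c \<noteq> 0" "\<not> integrable lborel \<phi>"
    and int: "AE y in dunkl_borel \<alpha>. integrable lborel (\<lambda>t. \<phi> t * (f (y / t) - c))"
  shows "AE y in dunkl_borel \<alpha>. H f y = 0"
  using int
proof eventually_elim
  case (elim y)
  have "\<not> integrable lborel (\<lambda>t. \<phi> t * f (y / t))"
  proof
    assume "integrable lborel (\<lambda>t. \<phi> t * f (y / t))"
    from Bochner_Integration.integrable_diff[OF this elim]
    have "integrable lborel (\<lambda>t. \<phi> t * c)" by (simp add: algebra_simps)
    from integrable_mult_left[OF this, of "inverse c"] show False
      using c by (simp add: mult.assoc)
  qed
  then show ?case by (simp add: H_def not_integrable_integral_eq)
qed

section \<open>Interchange of the translation with the operator\<close>

text \<open>The factor |t|^d_\<alpha> from the kernel cancels the one from the dilation of the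
  measure. On the right t occurs only inside f, so an integral over t can be moved past a fixed
  kernel.\<close>

lemma translation_scale:
  assumes [measurable]: "f \<in> borel_measurable borel"
    and "\<alpha> \<noteq> - 1 / 2" "x \<noteq> 0" "y \<noteq> 0" and t: "t \<noteq> 0"
  shows "dunkl_translation \<alpha> (x / t) f (y / t) =
    (LINT z|dunkl_borel \<alpha>. dunkl_W \<alpha> x y z *\<^sub>R f (z / t))"
proof -
  have "\<bar>t\<bar> powr dunkl_dim \<alpha> *\<^sub>R dunkl_translation \<alpha> (x / t) f (y / t) =
    \<bar>t\<bar> powr dunkl_dim \<alpha> *\<^sub>R (LINT z|dunkl_borel \<alpha>. dunkl_W \<alpha> (x / t) (y / t) z *\<^sub>R f z)"
    using assms by (simp add: dunkl_translation_borel[OF alpha])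
  also have "\<dots> = (LINT z|dunkl_borel \<alpha>. dunkl_W \<alpha> (x / t) (y / t) (z / t) *\<^sub>R f (z / t))"
    by (rule integral_dunkl_borel_scale[OF alpha _ t, symmetric]) measurable
  also have "\<dots> = (LINT z|dunkl_borel \<alpha>. \<bar>t\<bar> powr dunkl_dim \<alpha> *\<^sub>R (dunkl_W \<alpha> x y z *\<^sub>R f (z / t)))"
    by (simp only: dunkl_W_scale[OF t] scaleR_scaleR)
  also have "\<dots> = \<bar>t\<bar> powr dunkl_dim \<alpha> *\<^sub>R (LINT z|dunkl_borel \<alpha>. dunkl_W \<alpha> x y z *\<^sub>R f (z / t))"
    by (rule integral_scaleR_right)
  finally show ?thesis using t by simp
qed

text \<open>Absolute convergence of the triple integral on balls in y. With the t-integral performed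
  inside, the integrand is |W(x,y,z)| F(z). As W vanishes unless |z| \<le> |x| + |y|, z stays in a
  ball of radius R + |x|, and the y-integral of |W| is at most C; local integrability of F
  remains.\<close>

lemma translation_kernel_finite:
  assumes f [measurable]: "f \<in> borel_measurable borel"
    and \<alpha>: "\<alpha> \<noteq> - 1 / 2" and x: "x \<noteq> 0" and R: "0 < R"
    and fin: "\<And>R. 0 < R \<Longrightarrow>
      (\<integral>\<^sup>+y\<in>ball 0 R. (\<integral>\<^sup>+t. ennreal (norm (\<phi> t * f (y / t))) \<partial>lborel) \<partial>dunkl_borel \<alpha>) < \<infinity>"
  shows "(\<integral>\<^sup>+y\<in>ball 0 R. (\<integral>\<^sup>+t. (\<integral>\<^sup>+z. ennreal (norm (\<phi> t * (dunkl_W \<alpha> x y z *\<^sub>R f (z / t))))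
      \<partial>dunkl_borel \<alpha>) \<partial>lborel) \<partial>dunkl_borel \<alpha>) < \<infinity>"
proof -
  have "\<alpha> > - 1 / 2" using alpha \<alpha> by simp
  then obtain C where C: "\<And>x z. x \<noteq> 0 \<Longrightarrow> z \<noteq> 0 \<Longrightarrow>
    (\<integral>\<^sup>+y. ennreal \<bar>dunkl_W \<alpha> x y z\<bar> \<partial>dunkl_borel \<alpha>) \<le> ennreal C"
    using nn_integral_dunkl_W_bounded by blast
  define F where "F z = (\<integral>\<^sup>+t. ennreal (norm (\<phi> t * f (z / t))) \<partial>lborel)" for z
  have [measurable]: "F \<in> borel_measurable borel" unfolding F_def by measurable
  have inner: "(\<integral>\<^sup>+t. (\<integral>\<^sup>+z. ennreal (norm (\<phi> t * (dunkl_W \<alpha> x y z *\<^sub>R f (z / t)))) \<partial>dunkl_borel \<alpha>) \<partial>lborel) =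
    (\<integral>\<^sup>+z. ennreal \<bar>dunkl_W \<alpha> x y z\<bar> * F z \<partial>dunkl_borel \<alpha>)" for y
  proof -
    have "(\<integral>\<^sup>+t. (\<integral>\<^sup>+z. ennreal (norm (\<phi> t * (dunkl_W \<alpha> x y z *\<^sub>R f (z / t)))) \<partial>dunkl_borel \<alpha>) \<partial>lborel) =
      (\<integral>\<^sup>+z. (\<integral>\<^sup>+t. ennreal (norm (\<phi> t * (dunkl_W \<alpha> x y z *\<^sub>R f (z / t)))) \<partial>lborel) \<partial>dunkl_borel \<alpha>)"
      by (rule lm.Fubini'[symmetric]) measurable
    also have "\<dots> = (\<integral>\<^sup>+z. (\<integral>\<^sup>+t. ennreal \<bar>dunkl_W \<alpha> x y z\<bar> * ennreal (norm (\<phi> t * f (z / t))) \<partial>lborel) \<partial>dunkl_borel \<alpha>)"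
      by (simp add: norm_mult mult_ac flip: ennreal_mult)
    also have "\<dots> = (\<integral>\<^sup>+z. ennreal \<bar>dunkl_W \<alpha> x y z\<bar> * F z \<partial>dunkl_borel \<alpha>)"
      unfolding F_def by (intro nn_integral_cong nn_integral_cmult) measurable
    finally show ?thesis .
  qed
  have "(\<integral>\<^sup>+y\<in>ball 0 R. (\<integral>\<^sup>+z. ennreal \<bar>dunkl_W \<alpha> x y z\<bar> * F z \<partial>dunkl_borel \<alpha>) \<partial>dunkl_borel \<alpha>) =
    (\<integral>\<^sup>+y. \<integral>\<^sup>+z. ennreal \<bar>dunkl_W \<alpha> x y z\<bar> * F z * indicator (ball 0 R) y \<partial>dunkl_borel \<alpha> \<partial>dunkl_borel \<alpha>)"
    by (intro nn_integral_cong nn_integral_multc[symmetric]) measurable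
  also have "\<dots> = (\<integral>\<^sup>+z. \<integral>\<^sup>+y. ennreal \<bar>dunkl_W \<alpha> x y z\<bar> * F z * indicator (ball 0 R) y \<partial>dunkl_borel \<alpha> \<partial>dunkl_borel \<alpha>)"
    by (rule mm.Fubini') measurable
  also have "\<dots> \<le> (\<integral>\<^sup>+z. ennreal C * (F z * indicator (ball 0 (R + \<bar>x\<bar>)) z) \<partial>dunkl_borel \<alpha>)"
  proof (rule nn_integral_mono_AE)
    \<comment> \<open>The bound C is available only for z \<noteq> 0.\<close>
    have "AE z in dunkl_borel \<alpha>. z \<noteq> 0"
      by (simp add: AE_dunkl_borel_iff[OF alpha] AE_lborel_singleton)
    then show "AE z in dunkl_borel \<alpha>.
      (\<integral>\<^sup>+y. ennreal \<bar>dunkl_W \<alpha> x y z\<bar> * F z * indicator (ball 0 R) y \<partial>dunkl_borel \<alpha>)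
      \<le> ennreal C * (F z * indicator (ball 0 (R + \<bar>x\<bar>)) z)"
    proof eventually_elim
      case (elim z)
      have "(\<integral>\<^sup>+y. ennreal \<bar>dunkl_W \<alpha> x y z\<bar> * F z * indicator (ball 0 R) y \<partial>dunkl_borel \<alpha>) \<le>
        (\<integral>\<^sup>+y. ennreal \<bar>dunkl_W \<alpha> x y z\<bar> * (F z * indicator (ball 0 (R + \<bar>x\<bar>)) z) \<partial>dunkl_borel \<alpha>)"
      proof (rule nn_integral_mono)
        fix y
        show "ennreal \<bar>dunkl_W \<alpha> x y z\<bar> * F z * indicator (ball 0 R) y \<le>
            ennreal \<bar>dunkl_W \<alpha> x y z\<bar> * (F z * indicator (ball 0 (R + \<bar>x\<bar>)) z)"
        proof (cases "dunkl_W \<alpha> x y z = 0 \<or> y \<notin> ball 0 R")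
          case True
          then show ?thesis by auto
        next
          case False
          then have "z \<in> ball 0 (R + \<bar>x\<bar>)" using dunkl_W_support[of \<alpha> x y z] by auto
          then show ?thesis using False by simp
        qed
      qed
      also have "\<dots> = (\<integral>\<^sup>+y. ennreal \<bar>dunkl_W \<alpha> x y z\<bar> \<partial>dunkl_borel \<alpha>) *
          (F z * indicator (ball 0 (R + \<bar>x\<bar>)) z)"
        by (rule nn_integral_multc) measurable
      also have "\<dots> \<le> ennreal C * (F z * indicator (ball 0 (R + \<bar>x\<bar>)) z)"
        by (intro mult_right_mono C x elim) simp
      finally show ?case .
    qed
  qed
  also have "\<dots> = ennreal C * (\<integral>\<^sup>+z\<in>ball 0 (R + \<bar>x\<bar>). F z \<partial>dunkl_borel \<alpha>)"
    by (rule nn_integral_cmult) measurable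
  also have "\<dots> < \<infinity>"
    using fin[of "R + \<bar>x\<bar>"] R by (simp add: F_def ennreal_mult_less_top)
  finally show ?thesis unfolding inner .
qed

text \<open>A shift for \<alpha> = -1/2, the identity for x = 0, and otherwise Fubini's theorem at
  each y \<noteq> 0 where the absolute double integral \<open>Q y\<close> is finite. The point y = 0
  is set aside because the translation is evaluation at x there. The finiteness statement
  accompanies the identity because the means of the translated image require a second
  interchange.\<close>

lemma translation_H:
  assumes f [measurable]: "f \<in> borel_measurable borel"
    and fin: "\<And>R. 0 < R \<Longrightarrow>
      (\<integral>\<^sup>+y\<in>ball 0 R. (\<integral>\<^sup>+t. ennreal (norm (\<phi> t * f (y / t))) \<partial>lborel) \<partial>dunkl_borel \<alpha>) < \<infinity>"
  shows "0 < R \<Longrightarrow> (\<integral>\<^sup>+y\<in>ball 0 R. (\<integral>\<^sup>+t. ennreal (norm (\<phi> t * dunkl_translation \<alpha> (x / t) f (y / t)))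
      \<partial>lborel) \<partial>dunkl_borel \<alpha>) < \<infinity>" (is "_ \<Longrightarrow> ?fin R")
    and "AE y in dunkl_borel \<alpha>. dunkl_translation \<alpha> x (H f) y =
      (LINT t|lborel. \<phi> t * dunkl_translation \<alpha> (x / t) f (y / t))" (is ?eq)
proof -
  have "(\<forall>R>0. ?fin R) \<and> ?eq"
  proof (cases "\<alpha> = - 1 / 2")
    case True
    have tr: "dunkl_translation \<alpha> x f y = f (x + y)" for f x y
      using True by (simp add: dunkl_translation_def)
    have "?fin R" if "0 < R" for R
    proof -
      define F where "F y = (\<integral>\<^sup>+t. ennreal (norm (\<phi> t * f (y / t))) \<partial>lborel)" for y
      have [measurable]: "F \<in> borel_measurable borel" unfolding F_def by measurable
      have "(\<integral>\<^sup>+y\<in>ball 0 R. F (x + y) \<partial>dunkl_borel \<alpha>) \<le> (\<integral>\<^sup>+y\<in>ball 0 (R + \<bar>x\<bar>). F y \<partial>dunkl_borel \<alpha>)"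
        unfolding True by (rule nn_integral_ball_shift) measurable
      also have "\<dots> < \<infinity>" unfolding F_def using that by (intro fin) auto
      finally show ?thesis by (simp add: F_def tr add_divide_distrib)
    qed
    moreover have ?eq by (simp add: tr H_def add_divide_distrib)
    ultimately show ?thesis by blast
  next
    case \<alpha>: False
    have nz: "AE y in dunkl_borel \<alpha>. y \<noteq> 0"
      by (simp add: AE_dunkl_borel_iff[OF alpha] AE_lborel_singleton)
    show ?thesis
    proof (cases "x = 0")
      case True
      have "dunkl_translation \<alpha> 0 f y = f y" for f y
        using \<alpha> by (simp add: dunkl_translation_def)
      then show ?thesis using fin by (simp add: True H_def)
    next
      case x: False
      define Q where "Q y = (\<integral>\<^sup>+t. (\<integral>\<^sup>+z. ennreal (norm (\<phi> t * (dunkl_W \<alpha> x y z *\<^sub>R f (z / t))))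
        \<partial>dunkl_borel \<alpha>) \<partial>lborel)" for y
      have [measurable]: "Q \<in> borel_measurable borel" unfolding Q_def by measurable
      have Qfin: "(\<integral>\<^sup>+y\<in>ball 0 R. Q y \<partial>dunkl_borel \<alpha>) < \<infinity>" if "0 < R" for R
        unfolding Q_def by (rule translation_kernel_finite[OF f \<alpha> x that fin])
      have T: "\<phi> t * dunkl_translation \<alpha> (x / t) f (y / t) =
          (LINT z|dunkl_borel \<alpha>. \<phi> t * (dunkl_W \<alpha> x y z *\<^sub>R f (z / t)))" if "y \<noteq> 0" for t y
      proof (cases "t = 0")
        case False
        then show ?thesis
          unfolding integral_mult_right_zero by (simp only: translation_scale[OF f \<alpha> x that False])
      qed (simp add: phi_zero)
      have "?fin R" if "0 < R" for R
      proof -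
        have "(\<integral>\<^sup>+y\<in>ball 0 R. (\<integral>\<^sup>+t. ennreal (norm (\<phi> t * dunkl_translation \<alpha> (x / t) f (y / t)))
            \<partial>lborel) \<partial>dunkl_borel \<alpha>) \<le> (\<integral>\<^sup>+y\<in>ball 0 R. Q y \<partial>dunkl_borel \<alpha>)"
        proof (rule nn_integral_mono_AE, use nz in eventually_elim)
          case (elim y)
          have "ennreal (norm (\<phi> t * dunkl_translation \<alpha> (x / t) f (y / t))) \<le>
            (\<integral>\<^sup>+z. ennreal (norm (\<phi> t * (dunkl_W \<alpha> x y z *\<^sub>R f (z / t)))) \<partial>dunkl_borel \<alpha>)" for t
            unfolding T[OF elim]
            by (rule norm_integral_le_nn_integral)
          then show ?case unfolding Q_def by (intro mult_right_mono nn_integral_mono) auto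
        qed
        then show ?thesis using Qfin[OF that] by (rule le_less_trans)
      qed
      moreover have ?eq
      proof -
        have "AE y in dunkl_borel \<alpha>. Q y < \<infinity>" by (rule AE_ball_finite[OF _ Qfin]) measurable
        with nz show ?thesis
        proof eventually_elim
          case (elim y)
          have int: "integrable (lborel \<Otimes>\<^sub>M dunkl_borel \<alpha>) (\<lambda>(t, z). \<phi> t * (dunkl_W \<alpha> x y z *\<^sub>R f (z / t)))"
            using elim(2) unfolding Q_def by (intro lm.integrable_pairI) measurable
          have "dunkl_translation \<alpha> x (H f) y = (LINT z|dunkl_borel \<alpha>. dunkl_W \<alpha> x y z *\<^sub>R H f z)"
            using \<alpha> x elim(1) by (simp add: dunkl_translation_borel[OF alpha])
          also have "\<dots> = (LINT z|dunkl_borel \<alpha>. LINT t|lborel. \<phi> t * (dunkl_W \<alpha> x y z *\<^sub>R f (z / t)))"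
            unfolding H_def by (simp flip: integral_scaleR_right)
          also have "\<dots> = (LINT t|lborel. LINT z|dunkl_borel \<alpha>. \<phi> t * (dunkl_W \<alpha> x y z *\<^sub>R f (z / t)))"
            by (rule lm.Fubini_integral[OF int])
          also have "\<dots> = (LINT t|lborel. \<phi> t * dunkl_translation \<alpha> (x / t) f (y / t))"
            by (simp only: T[OF elim(1)])
          finally show ?case .
        qed
      qed
      ultimately show ?thesis by blast
    qed
  qed
  then show "0 < R \<Longrightarrow> ?fin R" ?eq by blast+
qed

text \<open>The mean over B(0,r) passes under the t-integral by a second use of Fubini's theorem.
  The oscillation of the image is then a superposition of the functions \<open>T t y - m t\<close>,
  each a dilate of the oscillation of f at x/t over the radius r/|t|, and \<open>minkowski\<close>
  applies.\<close>

lemma campanato_bound_H: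
  assumes f [measurable]: "f \<in> borel_measurable borel"
    and fin: "\<And>R. 0 < R \<Longrightarrow>
      (\<integral>\<^sup>+y\<in>ball 0 R. (\<integral>\<^sup>+t. ennreal (norm (\<phi> t * f (y / t))) \<partial>lborel) \<partial>dunkl_borel \<alpha>) < \<infinity>"
    and bound: "\<And>r x. 0 < r \<Longrightarrow> (\<integral>\<^sup>+y\<in>ball 0 r. ennreal (norm (dunkl_translation \<alpha> x f y - dunkl_mean \<alpha> r f x) powr p)
        \<partial>dunkl_borel \<alpha>) \<le> ennreal (dunkl_vol \<alpha> r * (N / r powr e) powr p)"
    and r: "0 < r"
  shows "(\<integral>\<^sup>+y\<in>ball 0 r. ennreal (norm (dunkl_translation \<alpha> x (H f) y - dunkl_mean \<alpha> r (H f) x) powr p)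
        \<partial>dunkl_borel \<alpha>) \<le> ennreal (dunkl_vol \<alpha> r * ((K * N) / r powr e) powr p)"
proof -
  have V: "dunkl_vol \<alpha> r > 0" by (rule emeasure_dunkl_borel_ball(2)[OF alpha r])
  define T where "T t y = dunkl_translation \<alpha> (x / t) f (y / t)" for t y
  have T_m: "case_prod T \<in> borel_measurable (borel \<Otimes>\<^sub>M borel)"
    unfolding T_def case_prod_beta by (rule measurable_dunkl_translation[OF alpha f]) measurable
  then have [measurable]: "case_prod T \<in> borel_measurable (lborel \<Otimes>\<^sub>M dunkl_borel \<alpha>)"
    "case_prod T \<in> borel_measurable (dunkl_borel \<alpha> \<Otimes>\<^sub>M lborel)"
    by (simp_all cong: measurable_cong_sets sets_pair_measure_cong)
  note T_m [measurable]
  define m where "m t = (LINT y:ball 0 r|dunkl_borel \<alpha>. T t y) /\<^sub>R dunkl_vol \<alpha> r" for t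
  have [measurable]: "m \<in> borel_measurable borel"
    unfolding m_def set_lebesgue_integral_def by measurable
  \<comment> \<open>The Jacobian of the dilation is absorbed by the ratio of the volumes of the two
    balls.\<close>
  have m_eq: "m t = dunkl_mean \<alpha> (r / \<bar>t\<bar>) f (x / t)" if t: "t \<noteq> 0" for t
  proof -
    have meas: "(\<lambda>y. dunkl_translation \<alpha> (x / t) f y) \<in> borel_measurable borel"
      by (rule measurable_dunkl_translation[OF alpha f]) auto
    show ?thesis
      unfolding m_def T_def dunkl_mean_borel[OF alpha f] integral_dunkl_ball_scale[OF alpha meas t]
        emeasure_dunkl_borel_ball(3)[OF alpha t]
      by (simp add: divide_inverse mult.commute)
  qed
  have finT: "(\<integral>\<^sup>+y\<in>ball 0 R. (\<integral>\<^sup>+t. ennreal (norm (\<phi> t * T t y)) \<partial>lborel) \<partial>dunkl_borel \<alpha>) < \<infinity>"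
    if "0 < R" for R
    unfolding T_def using translation_H(1)[OF f fin that] .
  have eqT: "AE y in dunkl_borel \<alpha>. dunkl_translation \<alpha> x (H f) y = (LINT t|lborel. \<phi> t * T t y)"
    unfolding T_def by (rule translation_H(2)[OF f fin])
  have intT: "AE y in dunkl_borel \<alpha>. integrable lborel (\<lambda>t. \<phi> t * T t y)"
  proof -
    have "AE y in dunkl_borel \<alpha>. (\<integral>\<^sup>+t. ennreal (norm (\<phi> t * T t y)) \<partial>lborel) < \<infinity>"
      by (rule AE_ball_finite[OF _ finT]) measurable
    then show ?thesis
    proof eventually_elim
      case (elim y)
      have [measurable]: "(\<lambda>t. T t y) \<in> borel_measurable borel" by measurable
      show ?case using elim by (intro integrableI_bounded) auto
    qed
  qed
  \<comment> \<open>This gives both the integrability of \<open>\<phi> t * m t\<close> and the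
    exchange of the mean with the t-integral.\<close>
  have int2: "integrable (lborel \<Otimes>\<^sub>M dunkl_borel \<alpha>) (\<lambda>(t, y). indicator (ball 0 r) y *\<^sub>R (\<phi> t * T t y))"
  proof (rule lm.integrable_pairI)
    have "(\<integral>\<^sup>+t. \<integral>\<^sup>+y. ennreal (norm (indicator (ball 0 r) y *\<^sub>R (\<phi> t * T t y))) \<partial>dunkl_borel \<alpha> \<partial>lborel) =
      (\<integral>\<^sup>+y. \<integral>\<^sup>+t. ennreal (norm (indicator (ball 0 r) y *\<^sub>R (\<phi> t * T t y))) \<partial>lborel \<partial>dunkl_borel \<alpha>)"
      by (rule lm.Fubini'[symmetric]) measurable
    also have "\<dots> = (\<integral>\<^sup>+y\<in>ball 0 r. (\<integral>\<^sup>+t. ennreal (norm (\<phi> t * T t y)) \<partial>lborel) \<partial>dunkl_borel \<alpha>)"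
      by (intro nn_integral_cong) (simp add: indicator_def)
    finally show "(\<integral>\<^sup>+t. \<integral>\<^sup>+y. ennreal (norm (indicator (ball 0 r) y *\<^sub>R (\<phi> t * T t y))) \<partial>dunkl_borel \<alpha> \<partial>lborel) < \<infinity>"
      using finT[OF r] by simp
  qed measurable
  have inner: "(LINT y|dunkl_borel \<alpha>. indicator (ball 0 r) y *\<^sub>R (\<phi> t * T t y)) = dunkl_vol \<alpha> r *\<^sub>R (\<phi> t * m t)" for t
  proof -
    have "(LINT y|dunkl_borel \<alpha>. indicator (ball 0 r) y *\<^sub>R (\<phi> t * T t y)) =
      \<phi> t * (LINT y:ball 0 r|dunkl_borel \<alpha>. T t y)"
      unfolding set_lebesgue_integral_def
      by (simp flip: integral_mult_right_zero mult_scaleR_right)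
    then show ?thesis using V by (simp add: m_def)
  qed
  have int_m: "integrable lborel (\<lambda>t. \<phi> t * m t)"
  proof -
    have "integrable lborel (\<lambda>t. dunkl_vol \<alpha> r *\<^sub>R (\<phi> t * m t))"
      using lm.integrable_fst'[OF int2] by (simp add: inner)
    from integrable_scaleR_right[OF this, of "inverse (dunkl_vol \<alpha> r)"] show ?thesis using V by simp
  qed
  have mean: "dunkl_mean \<alpha> r (H f) x = (LINT t|lborel. \<phi> t * m t)"
  proof -
    have [measurable]: "(\<lambda>y. dunkl_translation \<alpha> x (H f) y) \<in> borel_measurable borel"
      by (rule measurable_dunkl_translation[OF alpha]) auto
    have "(LINT y:ball 0 r|dunkl_borel \<alpha>. dunkl_translation \<alpha> x (H f) y) =
      (LINT y|dunkl_borel \<alpha>. LINT t|lborel. indicator (ball 0 r) y *\<^sub>R (\<phi> t * T t y))"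
      unfolding set_lebesgue_integral_def
    proof (rule integral_cong_AE)
      show "AE y in dunkl_borel \<alpha>. indicator (ball 0 r) y *\<^sub>R dunkl_translation \<alpha> x (H f) y =
          (LINT t|lborel. indicator (ball 0 r) y *\<^sub>R (\<phi> t * T t y))"
        using eqT by eventually_elim simp
    qed measurable
    also have "\<dots> = (LINT t|lborel. LINT y|dunkl_borel \<alpha>. indicator (ball 0 r) y *\<^sub>R (\<phi> t * T t y))"
      by (rule lm.Fubini_integral[OF int2])
    also have "\<dots> = dunkl_vol \<alpha> r *\<^sub>R (LINT t|lborel. \<phi> t * m t)"
      by (simp add: inner)
    finally show ?thesis
      using V by (subst dunkl_mean_borel[OF alpha]) auto
  qed
  have "(\<integral>\<^sup>+y\<in>ball 0 r. ennreal (norm (dunkl_translation \<alpha> x (H f) y - dunkl_mean \<alpha> r (H f) x) powr p)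
      \<partial>dunkl_borel \<alpha>) =
    (\<integral>\<^sup>+y\<in>ball 0 r. ennreal (norm (LINT t|lborel. \<phi> t * (T t y - m t)) powr p) \<partial>dunkl_borel \<alpha>)"
  proof (rule nn_integral_cong_AE, use eqT intT in eventually_elim)
    case (elim y)
    have "dunkl_translation \<alpha> x (H f) y - dunkl_mean \<alpha> r (H f) x = (LINT t|lborel. \<phi> t * (T t y - m t))"
      unfolding elim(1) mean Bochner_Integration.integral_diff[OF elim(2) int_m, symmetric]
      by (simp add: algebra_simps)
    then show ?case by simp
  qed
  \<comment> \<open>Dilation turns the bound for f at radius r/|t| into one at radius r at the cost
    of |t|^(e p), the growth that \<open>minkowski\<close> admits.\<close>
  also have "\<dots> \<le> ennreal (K powr p * (dunkl_vol \<alpha> r * (N / r powr e) powr p))"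
  proof (rule minkowski)
    show "(\<lambda>(t, y). T t y - m t) \<in> borel_measurable (borel \<Otimes>\<^sub>M borel)" by measurable
    show "0 \<le> dunkl_vol \<alpha> r * (N / r powr e) powr p" using V by simp
    fix t :: real
    assume t: "t \<noteq> 0"
    show "(\<integral>\<^sup>+y\<in>ball 0 r. ennreal (norm (T t y - m t) powr p) \<partial>dunkl_borel \<alpha>)
        \<le> ennreal (dunkl_vol \<alpha> r * (N / r powr e) powr p * \<bar>t\<bar> powr (e * p))"
      unfolding T_def m_eq[OF t]
    proof (rule ball_scaled_bound[OF _ t r])
      have "(\<lambda>y. dunkl_translation \<alpha> (x / t) f y) \<in> borel_measurable borel"
        by (rule measurable_dunkl_translation[OF alpha f]) auto
      then show "(\<lambda>y. dunkl_translation \<alpha> (x / t) f y - dunkl_mean \<alpha> (r / \<bar>t\<bar>) f (x / t))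
          \<in> borel_measurable borel"
        by measurable
    qed (use r t in \<open>auto intro!: bound\<close>)
  qed
  also have "K powr p * (dunkl_vol \<alpha> r * (N / r powr e) powr p) =
      dunkl_vol \<alpha> r * ((K * N) / r powr e) powr p"
    by (simp add: powr_mult powr_divide)
  finally show ?thesis .
qed

end

section \<open>Boundedness on Campanato spaces\<close>

text \<open>Both functions are exchanged at once; the exceptional set of t depends on x but is null
  for every x \<noteq> 0.\<close>

lemma hausdorff_op_AE_eq:
  assumes [measurable]: "\<psi>' \<in> borel_measurable borel" "f' \<in> borel_measurable borel"
    and \<psi>: "AE t in lborel. \<psi> t = \<psi>' t" and f: "AE y in lborel. f y = f' y" and x: "x \<noteq> 0"
  shows "hausdorff_op \<alpha> \<psi> f x =
    (LINT t|lborel. (\<psi>' t /\<^sub>R \<bar>t\<bar> powr dunkl_dim \<alpha>) * f' (x / t))"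
proof -
  have [measurable]: "(\<lambda>t. (\<psi>' t /\<^sub>R \<bar>t\<bar> powr dunkl_dim \<alpha>) * f' (x / t)) \<in> borel_measurable borel"
    by measurable
  have eq: "AE t in lborel. (\<psi> t /\<^sub>R \<bar>t\<bar> powr (2 * \<alpha> + 2)) * f (x / t) =
      (\<psi>' t /\<^sub>R \<bar>t\<bar> powr dunkl_dim \<alpha>) * f' (x / t)"
    using \<psi> AE_lborel_inverse[OF f x] by eventually_elim (simp add: dunkl_dim_def)
  have "hausdorff_op \<alpha> \<psi> f x =
      (LINT t|lebesgue. (\<psi>' t /\<^sub>R \<bar>t\<bar> powr dunkl_dim \<alpha>) * f' (x / t))"
    unfolding hausdorff_op_def
    by (intro integral_cong_AE AE_completion eq measurable_lebesgue_AE[OF _ eq] measurable_completion)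
       simp_all
  also have "\<dots> = (LINT t|lborel. (\<psi>' t /\<^sub>R \<bar>t\<bar> powr dunkl_dim \<alpha>) * f' (x / t))"
    by (rule integral_completion) simp
  finally show ?thesis .
qed

lemma campanato_norm_zero:
  assumes "\<alpha> \<ge> - 1 / 2" "0 < p"
  shows "campanato_norm \<alpha> p q (\<lambda>_. 0) = 0"
proof -
  have tr: "dunkl_translation \<alpha> x (\<lambda>_. 0) y = 0" for x y
    by (simp add: dunkl_translation_def)
  have "campanato_norm \<alpha> p q (\<lambda>_. 0) \<le> ennreal 0"
    by (subst campanato_norm_le_iff[OF assms(1) _ assms(2)])
       (simp_all add: tr dunkl_mean_def set_lebesgue_integral_def)
  then show ?thesis by simp
qed

theorem theorem3p4:
  fixes \<alpha> p q :: real and \<psi> :: "real \<Rightarrow> complex"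
  assumes "\<alpha> \<ge> - 1 / 2"
    and "1 \<le> p" and "p \<le> q"
    and "\<psi> \<in> borel_measurable lebesgue"
    and "hausdorff_const \<alpha> q \<psi> < \<infinity>"
  shows "\<forall>f \<in> campanato_space \<alpha> p q.
    hausdorff_op \<alpha> \<psi> f \<in> campanato_space \<alpha> p q \<and>
    campanato_norm \<alpha> p q (hausdorff_op \<alpha> \<psi> f)
      \<le> hausdorff_const \<alpha> q \<psi> * campanato_norm \<alpha> p q f"
proof
  fix f0 assume f0: "f0 \<in> campanato_space \<alpha> p q"
  note \<alpha> = assms(1)
  have p0: "0 < p" and q: "0 < q" using assms by auto
  have f0m: "f0 \<in> borel_measurable lebesgue"
    using f0 by (simp add: campanato_space_def locally_p_integrable_def borel_measurable_dunkl_measure)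
  obtain f where f [measurable]: "f \<in> borel_measurable borel" and ff0: "AE x in lborel. f0 x = f x"
    using lebesgue_AE_eq_borel[OF f0m] .
  obtain \<psi>' where \<psi>' [measurable]: "\<psi>' \<in> borel_measurable borel" and \<psi>: "AE t in lborel. \<psi> t = \<psi>' t"
    using lebesgue_AE_eq_borel[OF assms(4)] .
  define e where "e = dunkl_dim \<alpha> / q"
  have e: "0 < e" using \<alpha> q by (simp add: e_def dunkl_dim_def)
  obtain K where hK: "hausdorff_const \<alpha> q \<psi> = ennreal K" "0 \<le> K"
    using assms(5) by (cases "hausdorff_const \<alpha> q \<psi>") auto
  have "(\<integral>\<^sup>+t. ennreal (norm (\<psi>' t) / \<bar>t\<bar> powr (dunkl_dim \<alpha> - e)) \<partial>lborel) = hausdorff_const \<alpha> q \<psi>"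
    unfolding hausdorff_const_def nn_integral_completion
    by (rule nn_integral_cong_AE, use \<psi> in eventually_elim) (simp add: e_def right_diff_distrib)
  then interpret dunkl_hausdorff \<alpha> p e K \<psi>'
    using \<alpha> assms(2) e hK \<psi>' by unfold_locales auto
  obtain N where N: "campanato_norm \<alpha> p q f0 = ennreal N" "0 \<le> N"
    using f0 by (cases "campanato_norm \<alpha> p q f0") (auto simp: campanato_space_def)
  have "campanato_norm \<alpha> p q f \<le> ennreal N"
    using campanato_norm_cong_AE[OF \<alpha> f ff0] N by simp
  then have bound: "(\<integral>\<^sup>+y\<in>ball 0 r. ennreal (norm (dunkl_translation \<alpha> x f y - dunkl_mean \<alpha> r f x) powr p)
        \<partial>dunkl_borel \<alpha>) \<le> ennreal (dunkl_vol \<alpha> r * (N / r powr e) powr p)" if "0 < r" for r x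
    using that unfolding campanato_norm_le_iff[OF \<alpha> f p0 N(2)] e_def by blast
  \<comment> \<open>For x = 0 every branch of the definition returns f y, so the bound at 0 is one
    on the oscillation of f itself.\<close>
  have "dunkl_translation \<alpha> 0 f y = f y" for y by (simp add: dunkl_translation_def)
  then have bound0: "(\<integral>\<^sup>+y\<in>ball 0 r. ennreal (norm (f y - dunkl_mean \<alpha> r f 0) powr p) \<partial>dunkl_borel \<alpha>)
      \<le> ennreal (dunkl_vol \<alpha> r * (N / r powr e) powr p)" if "0 < r" for r
    using bound[OF that, of 0] by simp
  obtain c M where M: "0 \<le> M" and g:
    "\<And>r. 0 < r \<Longrightarrow> (\<integral>\<^sup>+y\<in>ball 0 r. ennreal (norm (f y - c) powr p) \<partial>dunkl_borel \<alpha>)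
      \<le> ennreal (dunkl_vol \<alpha> r * (M / r powr e) powr p)"
  proof (rule morrey_decomposition[OF \<alpha> f assms(2) e N(2) bound0])
    fix c M
    assume "0 \<le> M" "\<And>r. 0 < r \<Longrightarrow>
      (\<integral>\<^sup>+y\<in>ball 0 r. ennreal (norm (f y - c) powr p) \<partial>dunkl_borel \<alpha>)
      \<le> ennreal (dunkl_vol \<alpha> r * (M / r powr e) powr p)"
    then show thesis by (rule that)
  qed
  have g_fin: "(\<integral>\<^sup>+y\<in>ball 0 R. (\<integral>\<^sup>+t. ennreal (norm (\<phi> t * (f (y / t) - c))) \<partial>lborel)
      \<partial>dunkl_borel \<alpha>) < \<infinity>" if "0 < R" for R
    by (rule H_morrey_finite[OF _ that M g]) measurable
  have g_int: "AE y in dunkl_borel \<alpha>. integrable lborel (\<lambda>t. \<phi> t * (f (y / t) - c))"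
    by (rule AE_integrable_kernel[OF _ g_fin]) measurable
  \<comment> \<open>The point x = 0 is left out: there the integrand depends on the value of
    \<open>f0\<close> at a single point, which may differ from that of \<open>f\<close>.\<close>
  have op: "AE x in lborel. hausdorff_op \<alpha> \<psi> f0 x = H f x"
    using AE_lborel_singleton[of "0::real"]
    by eventually_elim (simp add: hausdorff_op_AE_eq[OF \<psi>' f \<psi> ff0] H_def \<phi>_def)
  have "locally_p_integrable \<alpha> p (hausdorff_op \<alpha> \<psi> f0) \<and>
    campanato_norm \<alpha> p q (hausdorff_op \<alpha> \<psi> f0) \<le> ennreal (K * N)"
  proof (cases "c = 0 \<or> integrable lborel \<phi>")
    case True
    have f_fin: "(\<integral>\<^sup>+y\<in>ball 0 R. (\<integral>\<^sup>+t. ennreal (norm (\<phi> t * f (y / t))) \<partial>lborel) \<partial>dunkl_borel \<alpha>) < \<infinity>"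
      if "0 < R" for R
      by (rule kernel_finite_add_const[OF f that True g_fin[OF that]])
    have "campanato_norm \<alpha> p q (hausdorff_op \<alpha> \<psi> f0) = campanato_norm \<alpha> p q (H f)"
      by (rule campanato_norm_cong_AE[OF \<alpha> measurable_H[OF f] op])
    also have "\<dots> \<le> ennreal (K * N)"
      unfolding campanato_norm_le_iff[OF \<alpha> measurable_H[OF f] p0 mult_nonneg_nonneg[OF K0 N(2)]]
        e_def[symmetric]
      by (intro allI impI campanato_bound_H f f_fin bound)
    finally have "campanato_norm \<alpha> p q (hausdorff_op \<alpha> \<psi> f0) \<le> ennreal (K * N)" .
    moreover have "locally_p_integrable \<alpha> p (hausdorff_op \<alpha> \<psi> f0)"
      unfolding locally_p_integrable_iff[OF \<alpha> measurable_H[OF f] op]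
    proof (intro allI impI)
      fix R :: real assume R: "0 < R"
      \<comment> \<open>Almost everywhere \<open>H f\<close> differs from the image of f - c by this
        constant, which is locally p-integrable since balls have finite volume.\<close>
      define b where "b = (LINT t|lborel. \<phi> t * c)"
      have "(\<integral>\<^sup>+y\<in>ball 0 R. ennreal (norm (H f y) powr p) \<partial>dunkl_borel \<alpha>) =
        (\<integral>\<^sup>+y\<in>ball 0 R. ennreal (norm (H (\<lambda>z. f z - c) y + b) powr p) \<partial>dunkl_borel \<alpha>)"
        by (rule nn_integral_cong_AE, use AE_H_split[OF f True g_int] in eventually_elim)
           (simp add: b_def)
      also have "\<dots> \<le> ennreal (2 powr p) *
        ((\<integral>\<^sup>+y\<in>ball 0 R. ennreal (norm (H (\<lambda>z. f z - c) y) powr p) \<partial>dunkl_borel \<alpha>) +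
         (\<integral>\<^sup>+y\<in>ball 0 R. ennreal (norm b powr p) \<partial>dunkl_borel \<alpha>))"
        using p by (intro nn_integral_norm_add_powr_le) auto
      also have "\<dots> \<le> ennreal (2 powr p) * (ennreal (K powr p * (dunkl_vol \<alpha> R * (M / R powr e) powr p)) +
          ennreal (dunkl_vol \<alpha> R * norm b powr p))"
        by (intro mult_left_mono add_mono H_morrey_Lp R g) (auto simp: nn_integral_ball_const[OF \<alpha>])
      also have "\<dots> < \<infinity>" by (simp add: ennreal_mult_less_top)
      finally show "(\<integral>\<^sup>+y\<in>ball 0 R. ennreal (norm (H f y) powr p) \<partial>dunkl_borel \<alpha>) < \<infinity>" .
    qed
    ultimately show ?thesis by simp
  next
    case False
    \<comment> \<open>Both claims are trivial once the image is almost everywhere 0.\<close>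
    have "AE x in lborel. H f x = 0"
      using AE_H_zero[OF f _ _ g_int] False by (simp add: AE_dunkl_borel_iff[OF \<alpha>])
    with op have zero: "AE x in lborel. hausdorff_op \<alpha> \<psi> f0 x = (\<lambda>_. 0) x"
      by eventually_elim simp
    have "campanato_norm \<alpha> p q (hausdorff_op \<alpha> \<psi> f0) = 0"
      using campanato_norm_cong_AE[OF \<alpha> _ zero] campanato_norm_zero[OF \<alpha> p0] by simp
    moreover have "locally_p_integrable \<alpha> p (hausdorff_op \<alpha> \<psi> f0)"
      by (subst locally_p_integrable_iff[OF \<alpha> _ zero]) simp_all
    ultimately show ?thesis by simp
  qed
  moreover have "ennreal (K * N) = hausdorff_const \<alpha> q \<psi> * campanato_norm \<alpha> p q f0"
    using hK N by (simp add: ennreal_mult)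
  moreover have "ennreal (K * N) < \<infinity>" by simp
  ultimately show "hausdorff_op \<alpha> \<psi> f0 \<in> campanato_space \<alpha> p q \<and>
    campanato_norm \<alpha> p q (hausdorff_op \<alpha> \<psi> f0) \<le> hausdorff_const \<alpha> q \<psi> * campanato_norm \<alpha> p q f0"
    unfolding campanato_space_def by (auto intro: le_less_trans)
qed

end
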